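(* Let $n>3$. The positive function $H=h_1\cdots h_{n-1}/h_n$ on $\mathcal{M}_{0,n}$ determines a Hermitian metric in the line bundle $\lambda_{0,n}$ over $\mathfrak{M}_{0,n}$.
   Context: **Moduli space and covering map.** $\mathcal{M}_{0,n}=\{(w_1,\dots,w_{n-3})\in\mathbb{C}^{n-3}: w_i\ne0,1,\ w_i\neq w_k\text{ for }i\ne k\}$; put $w_{n-2}=0$, $w_{n-1}=1$, $w_n=\infty$. For a point of $\mathcal{M}_{0,n}$ let $X=\mathbb{C}\setminus\{w_1,\dots,w_{n-3},0,1\}\cong\Gamma\backslash\mathbb{H}$, $\mathbb{H}$ the upper half-plane, where $\Gamma\subset\mathrm{PSL}(2,\mathbb R)$ is a Fuchsian group generated by parabolic $S_1,\dots,S_n$ with $S_1\cdots S_n=1$ and fixed points $z_1,\dots,z_n$, normalized by $z_{n-2}=0$, $z_{n-1}=1$, $z_n=\infty$. Let $J:\mathbb{H}\to X$ be the covering map with deck group $\Gamma$ which extends to an isomorphism $\Gamma\backslash\mathbb{H}^*\to\bar{\mathbb{C}}$ ($\mathbb{H}^*$ = $\mathbb{H}$ with all cusps) fixing $0,1,\infty$, with $J(z_i)=w_i$. Let $\sigma_i\in\mathrm{PSL}(2,\mathbb{R})$ satisfy $\sigma_i\infty=z_i$ and $\sigma_i^{-1}S_i\sigma_i=\left(\begin{smallmatrix}1&\pm1\\0&1\end{smallmatrix}\right)$. With $q=e^{2\pi\sqrt{-1}z}$, $$J(\sigma_iz)=w_i+\sum_{k\ge1}a_i(k)q^k\ (i\le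 n-1),\qquad J(\sigma_nz)=\sum_{k\ge-1}a_n(k)q^k.$$ Put $h_i=|a_i(1)|^2$ for $i\le n-1$ and $h_n=|a_n(-1)|^2$; these are smooth positive functions on $\mathcal{M}_{0,n}$. **The line bundle $\lambda_{0,n}$.** $\mathrm{Symm}(n)$ acts on $\mathcal{M}_{0,n}$ by permuting the labels of the $n$ punctures $w_1,\dots,w_{n-3},0,1,\infty$ and renormalizing by the Möbius transformation that sends the last three to $0,1,\infty$; $\mathfrak{M}_{0,n}=\mathcal{M}_{0,n}/\mathrm{Symm}(n)$. Let $\{f_\sigma\}$ be the 1-cocycle given on the transpositions $\sigma_{kn}$ of indices $k$ and $n$ by $$f_{\sigma_{kn}}=\prod_{\substack{i=1\\i\neq k}}^{n-3}\frac{(w_i-w_k)^2}{w_k(w_k-1)}\ (k\le n-3),\quad f_{\sigma_{n-2,n}}=\prod_{i=1}^{n-3}w_i^2,\quad f_{\sigma_{n-1,n}}=\prod_{i=1}^{n-3}(w_i-1)^2,$$ and extended to the full group by $f_{\sigma_1\sigma_2}=(f_{\sigma_1}\circ\sigma_2)f_{\sigma_2}$. The holomorphic line bundle $\lambda_{0,n}$ over $\mathfrak{M}_{0,n}$ is the quotient of the trivial bundle $\mathcal{M}_{0,n}\times\mathbb{C}$ by $(\mathbf{w},z)\mapsto(\sigma\cdot\mathbf{w},f_\sigma(\mathbf{w})z)$. A smooth positive function $H$ on $\mathcal{M}_{0,n}$ determines a Hermitian metric in $\lambda_{0,n}$ (with squared norm $H(\mathbf{w})|z|^2$) if $H(\sigma\cdot\mathbf{w})|f_\sigma(\mathbf{w})|^2=H(\mathbf{w})$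 for all $\mathbf{w}\in\mathcal{M}_{0,n}$, $\sigma\in\mathrm{Symm}(n)$.
   Formalization: For odd n the prescribed values on the transpositions do not extend to an exact 1-cocycle (two words for the transposition of k and n-2 give opposite signs), so the cocycle relation is required only up to a constant sign; this leaves |f_σ|² unchanged and includes every exact cocycle. *)

theory Defs
  imports "HOL-Analysis.Analysis" "HOL-Algebra.Generated_Groups"
begin

text \<open>The Riemann sphere is \<^typ>\<open>complex option\<close>, with \<^term>\<open>None\<close> as the point at infinity.\<close>

type_synonym sphere = "complex option"

definition sphere_topology :: "sphere topology" where
  "sphere_topology = Alexandroff_compactification euclidean"

definition moebius :: "complex \<Rightarrow> complex \<Rightarrow> complex \<Rightarrow> complex \<Rightarrow> sphere \<Rightarrow> sphere" where
  "moebius a b c d x = (case x of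
      None \<Rightarrow> if c = 0 then None else Some (a / c)
    | Some z \<Rightarrow> if c * z + d = 0 then None else Some ((a * z + b) / (c * z + d)))"

definition Moebius_maps :: "(sphere \<Rightarrow> sphere) set" where
  "Moebius_maps = {moebius a b c d | a b c d. a * d - b * c \<noteq> 0}"

definition real_moebius :: "real \<Rightarrow> real \<Rightarrow> real \<Rightarrow> real \<Rightarrow> sphere \<Rightarrow> sphere" where
  "real_moebius a b c d =
     moebius (of_real a) (of_real b) (of_real c) (of_real d)"

text \<open>An element of $\mathrm{PSL}(2,\mathbb{R})$ is identified with the transformation of the
  sphere that it induces; the action is faithful.\<close>

definition PSL2R :: "(sphere \<Rightarrow> sphere) monoid" where
  "PSL2R = \<lparr>carrier = {real_moebius a b c d | a b c d. a * d - b * c = 1},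
            mult = (\<circ>), one = id\<rparr>"

definition parabolic :: "(sphere \<Rightarrow> sphere) \<Rightarrow> bool" where
  "parabolic g \<longleftrightarrow> g \<noteq> id \<and>
     (\<exists>a b c d. a * d - b * c = 1 \<and> \<bar>a + d\<bar> = 2 \<and> g = real_moebius a b c d)"

text \<open>Discreteness is tested on the preimage in $\mathrm{SL}(2,\mathbb{R})$, seen as a subset of
  \<open>\<real>\<^sup>4\<close>.\<close>

definition Fuchsian :: "(sphere \<Rightarrow> sphere) set \<Rightarrow> bool" where
  "Fuchsian \<Gamma> \<longleftrightarrow> subgroup \<Gamma> PSL2R \<and>
     discrete {(a, b, c, d). a * d - b * c = 1 \<and> real_moebius a b c d \<in> \<Gamma>}"

definition upper_half_plane :: "complex set" where
  "upper_half_plane = {z. Im z > 0}"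

definition cusps :: "(sphere \<Rightarrow> sphere) set \<Rightarrow> sphere set" where
  "cusps \<Gamma> = {x. \<exists>g\<in>\<Gamma>. parabolic g \<and> g x = x}"

definition extended_half_plane :: "(sphere \<Rightarrow> sphere) set \<Rightarrow> sphere set" where
  "extended_half_plane \<Gamma> = Some ` upper_half_plane \<union> cusps \<Gamma>"

text \<open>The topology of \<open>\<H>\<^sup>*\<close>: a neighbourhood of a cusp contains a horodisc tangent to the boundary
  at that cusp, i.e. the image of some \<open>Im z > Y\<close> under an element of $\mathrm{PSL}(2,\mathbb{R})$
  that moves infinity to the cusp.\<close>

definition horocycle_open :: "(sphere \<Rightarrow> sphere) set \<Rightarrow> sphere set \<Rightarrow> bool" where
  "horocycle_open \<Gamma> U \<longleftrightarrow> U \<subseteq> extended_half_plane \<Gamma> \<and>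
     open {z \<in> upper_half_plane. Some z \<in> U} \<and>
     (\<forall>g \<in> carrier PSL2R. g None \<in> U \<inter> cusps \<Gamma> \<longrightarrow>
        (\<exists>Y>0. \<forall>z. Im z > Y \<longrightarrow> g (Some z) \<in> U))"

definition horocycle_topology :: "(sphere \<Rightarrow> sphere) set \<Rightarrow> sphere topology" where
  "horocycle_topology \<Gamma> = topology (horocycle_open \<Gamma>)"

lemma real_moebius_half_plane:
  assumes "a * d - b * c = 1" "Im z > 0"
  shows "\<exists>z'. Im z' > 0 \<and> real_moebius a b c d (Some z) = Some z'"
proof -
  define den where "den = complex_of_real c * z + complex_of_real d"
  have "den \<noteq> 0"
  proof
    assume "den = 0"
    then have "Im den = 0" "Re den = 0" by auto
    then have "c = 0" "d = 0" using assms(2) by (auto simp: den_def)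
    with assms(1) show False by simp
  qed
  define num where "num = complex_of_real a * z + complex_of_real b"
  have "Im (num / den) = (Im num * Re den - Re num * Im den) / ((Re den)\<^sup>2 + (Im den)\<^sup>2)"
    by (simp add: Im_divide)
  also have "Im num * Re den - Re num * Im den = (a * d - b * c) * Im z"
    by (simp add: num_def den_def algebra_simps)
  finally have "Im (num / den) = Im z / ((Re den)\<^sup>2 + (Im den)\<^sup>2)"
    using assms(1) by simp
  moreover have "(Re den)\<^sup>2 + (Im den)\<^sup>2 > 0"
    using \<open>den \<noteq> 0\<close> by (metis complex_eq_iff sum_power2_gt_zero_iff zero_complex.sel)
  ultimately have "Im (num / den) > 0" using assms(2) by simp
  with \<open>den \<noteq> 0\<close> show ?thesis
    by (auto simp: real_moebius_def moebius_def num_def den_def)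
qed

lemma istopology_horocycle_open: "istopology (horocycle_open \<Gamma>)"
  unfolding istopology_def
proof (intro conjI allI impI)
  fix U V assume U: "horocycle_open \<Gamma> U" and V: "horocycle_open \<Gamma> V"
  have "{z \<in> upper_half_plane. Some z \<in> U \<inter> V} =
      {z \<in> upper_half_plane. Some z \<in> U} \<inter> {z \<in> upper_half_plane. Some z \<in> V}" by auto
  then have "open {z \<in> upper_half_plane. Some z \<in> U \<inter> V}"
    using U V by (simp add: horocycle_open_def open_Int)
  moreover have "\<exists>Y>0. \<forall>z. Im z > Y \<longrightarrow> g (Some z) \<in> U \<inter> V"
    if g: "g \<in> carrier PSL2R" "g None \<in> (U \<inter> V) \<inter> cusps \<Gamma>" for g
  proof -
    obtain Y where "Y > 0" "\<forall>z. Im z > Y \<longrightarrow> g (Some z) \<in> U"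
      using U g unfolding horocycle_open_def by blast
    moreover obtain Y' where "Y' > 0" "\<forall>z. Im z > Y' \<longrightarrow> g (Some z) \<in> V"
      using V g unfolding horocycle_open_def by blast
    ultimately show ?thesis by (intro exI[of _ "max Y Y'"]) auto
  qed
  ultimately show "horocycle_open \<Gamma> (U \<inter> V)"
    using U unfolding horocycle_open_def by blast
next
  fix \<U> assume *: "\<forall>U\<in>\<U>. horocycle_open \<Gamma> U"
  have "{z \<in> upper_half_plane. Some z \<in> \<Union>\<U>} =
      (\<Union>U\<in>\<U>. {z \<in> upper_half_plane. Some z \<in> U})" by auto
  then have "open {z \<in> upper_half_plane. Some z \<in> \<Union>\<U>}"
    using * by (simp add: horocycle_open_def open_UN)
  moreover have "\<exists>Y>0. \<forall>z. Im z > Y \<longrightarrow> g (Some z) \<in> \<Union>\<U>"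
    if g: "g \<in> carrier PSL2R" "g None \<in> \<Union>\<U> \<inter> cusps \<Gamma>" for g
  proof -
    obtain U where U: "U \<in> \<U>" "g None \<in> U \<inter> cusps \<Gamma>" using g by auto
    then obtain Y where "Y > 0" "\<forall>z. Im z > Y \<longrightarrow> g (Some z) \<in> U"
      using * g(1) unfolding horocycle_open_def by blast
    with U(1) show ?thesis by blast
  qed
  ultimately show "horocycle_open \<Gamma> (\<Union>\<U>)"
    using * unfolding horocycle_open_def by blast
qed

lemma openin_horocycle_topology: "openin (horocycle_topology \<Gamma>) = horocycle_open \<Gamma>"
  by (simp add: horocycle_topology_def istopology_horocycle_open topology_inverse')

lemma topspace_horocycle_topology: "topspace (horocycle_topology \<Gamma>) = extended_half_plane \<Gamma>"
proof -
  have "\<exists>Y>0. \<forall>z. Im z > Y \<longrightarrow> g (Some z) \<in> extended_half_plane \<Gamma>"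
    if "g \<in> carrier PSL2R" for g
  proof -
    have "g (Some z) \<in> extended_half_plane \<Gamma>" if "Im z > 1" for z
    proof -
      obtain a b c d where "g = real_moebius a b c d" "a * d - b * c = 1"
        using \<open>g \<in> carrier PSL2R\<close> by (auto simp: PSL2R_def)
      moreover have "Im z > 0" using that by simp
      ultimately show ?thesis
        using real_moebius_half_plane[of a d b c z]
        by (auto simp: extended_half_plane_def upper_half_plane_def)
    qed
    then show ?thesis by (intro exI[of _ 1]) auto
  qed
  moreover have "{z \<in> upper_half_plane. Some z \<in> extended_half_plane \<Gamma>} = upper_half_plane"
    by (auto simp: extended_half_plane_def)
  moreover have "open upper_half_plane"
    by (simp add: upper_half_plane_def open_halfspace_Im_gt)
  ultimately have "horocycle_open \<Gamma> (extended_half_plane \<Gamma>)"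
    by (simp add: horocycle_open_def)
  then show ?thesis
    unfolding topspace_def openin_horocycle_topology by (auto simp: horocycle_open_def)
qed

text \<open>Points of \<open>\<M>\<^sub>0\<^sub>,\<^sub>n\<close> are functions on \<open>{1..n-3}\<close>, extended by \<^term>\<open>undefined\<close>.\<close>

definition moduli :: "nat \<Rightarrow> (nat \<Rightarrow> complex) set" where
  "moduli n = {w \<in> {1..n-3} \<rightarrow>\<^sub>E UNIV - {0, 1}. inj_on w {1..n-3}}"

definition puncture :: "nat \<Rightarrow> (nat \<Rightarrow> complex) \<Rightarrow> nat \<Rightarrow> sphere" where
  "puncture n w i =
     (if i = n then None else if i = n - 1 then Some 1 else if i = n - 2 then Some 0
      else Some (w i))"

text \<open>The label \<open>i\<close> is moved to \<open>p i\<close>, so the new \<open>i\<close>-th puncture is the old one with label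
  \<open>p\<inverse> i\<close>. This makes the action a left action, as the relation
  \<open>f\<^bsub>p\<^sub>1 p\<^sub>2\<^esub> = (f\<^bsub>p\<^sub>1\<^esub> \<circ> p\<^sub>2) f\<^bsub>p\<^sub>2\<^esub>\<close> requires.\<close>

definition relabel :: "nat \<Rightarrow> (nat \<Rightarrow> nat) \<Rightarrow> (nat \<Rightarrow> complex) \<Rightarrow> (nat \<Rightarrow> sphere)" where
  "relabel n p w i = puncture n w (inv_into UNIV p i)"

definition renormalization :: "(nat \<Rightarrow> sphere) \<Rightarrow> nat \<Rightarrow> (sphere \<Rightarrow> sphere)" where
  "renormalization x n =
     (THE m. m \<in> Moebius_maps \<and>
        m (x (n - 2)) = Some 0 \<and> m (x (n - 1)) = Some 1 \<and> m (x n) = None)"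

definition symm_act :: "nat \<Rightarrow> (nat \<Rightarrow> nat) \<Rightarrow> (nat \<Rightarrow> complex) \<Rightarrow> (nat \<Rightarrow> complex)" where
  "symm_act n p w =
     (\<lambda>i\<in>{1..n-3}. the (renormalization (relabel n p w) n (relabel n p w i)))"

text \<open>\<open>C\<^sup>k\<close> functions in the real coordinates \<open>Re w\<^sub>j\<close> and \<open>Im w\<^sub>j\<close>: the partial derivatives are
  those in the directions \<open>u = 1\<close> and \<open>u = \<i>\<close> of the \<open>j\<close>-th coordinate.\<close>

definition partial_deriv ::
    "nat \<Rightarrow> complex \<Rightarrow> ((nat \<Rightarrow> complex) \<Rightarrow> real) \<Rightarrow> (nat \<Rightarrow> complex) \<Rightarrow> real" where
  "partial_deriv j u F w = deriv (\<lambda>t::real. F (w(j := w j + of_real t * u))) 0"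

primrec Ck_on_moduli :: "nat \<Rightarrow> nat \<Rightarrow> ((nat \<Rightarrow> complex) \<Rightarrow> real) \<Rightarrow> bool" where
  "Ck_on_moduli n 0 F \<longleftrightarrow> continuous_on (moduli n) F"
| "Ck_on_moduli n (Suc k) F \<longleftrightarrow> continuous_on (moduli n) F \<and>
     (\<forall>j\<in>{1..n-3}. \<forall>u\<in>{1, \<i>}.
        (\<forall>w\<in>moduli n. (\<lambda>t::real. F (w(j := w j + of_real t * u))) differentiable at 0) \<and>
        Ck_on_moduli n k (partial_deriv j u F))"

definition smooth_on_moduli :: "nat \<Rightarrow> ((nat \<Rightarrow> complex) \<Rightarrow> real) \<Rightarrow> bool" where
  "smooth_on_moduli n F \<longleftrightarrow> (\<forall>k. Ck_on_moduli n k F)"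

definition cusp_q :: "complex \<Rightarrow> complex" where
  "cusp_q z = exp (2 * of_real pi * \<i> * z)"

locale uniformization =
  fixes n :: nat
    and w :: "nat \<Rightarrow> complex"
    and \<Gamma> :: "(sphere \<Rightarrow> sphere) set"
    and S :: "nat \<Rightarrow> sphere \<Rightarrow> sphere"
    and z :: "nat \<Rightarrow> sphere"
    and J :: "complex \<Rightarrow> complex"
    and \<sigma> :: "nat \<Rightarrow> sphere \<Rightarrow> sphere"
    and a :: "nat \<Rightarrow> int \<Rightarrow> complex"
  assumes fuchsian: "Fuchsian \<Gamma>"
    and parabolic_S: "\<And>i. i \<in> {1..n} \<Longrightarrow> parabolic (S i)"
    and generated: "\<Gamma> = generate PSL2R (S ` {1..n})"
    and product_S:
      "foldr (\<lambda>i g. S i \<otimes>\<^bsub>PSL2R\<^esub> g) [1..<Suc n] \<one>\<^bsub>PSL2R\<^esub> = \<one>\<^bsub>PSL2R\<^esub>"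
    and fixed_point: "\<And>i. i \<in> {1..n} \<Longrightarrow> S i (z i) = z i"
    and normalized: "z (n - 2) = Some 0" "z (n - 1) = Some 1" "z n = None"
    and holomorphic_J: "J holomorphic_on upper_half_plane"
    and covering_J:
      "covering_space upper_half_plane J (UNIV - ({0, 1} \<union> w ` {1..n-3}))"
    \<comment> \<open>The fibres are the \<open>\<Gamma>\<close>-orbits, i.e. \<open>J\<close> identifies the quotient by \<open>\<Gamma>\<close> with the
        punctured sphere and has deck group \<open>\<Gamma>\<close>.\<close>
    and fibres_J: "\<And>x y. x \<in> upper_half_plane \<Longrightarrow> y \<in> upper_half_plane \<Longrightarrow>
        J x = J y \<longleftrightarrow> (\<exists>g\<in>\<Gamma>. g (Some x) = Some y)"
    \<comment> \<open>The induced bijection of \<open>\<Gamma>\<close>-orbits in \<open>\<H>\<^sup>*\<close> with the sphere is a homeomorphism; being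
        holomorphic off the finitely many cusps, it is an isomorphism of Riemann surfaces.\<close>
    and extends_J: "\<exists>Jx. (\<forall>x\<in>upper_half_plane. Jx (Some x) = Some (J x)) \<and>
        quotient_map (horocycle_topology \<Gamma>) sphere_topology Jx \<and>
        (\<forall>x\<in>extended_half_plane \<Gamma>. \<forall>y\<in>extended_half_plane \<Gamma>.
           Jx x = Jx y \<longleftrightarrow> (\<exists>g\<in>\<Gamma>. g x = y)) \<and>
        (\<forall>i\<in>{1..n}. Jx (z i) = puncture n w i)"
    and scaling: "\<And>i. i \<in> {1..n} \<Longrightarrow> \<sigma> i \<in> carrier PSL2R"
      "\<And>i. i \<in> {1..n} \<Longrightarrow> \<sigma> i None = z i"
      "\<And>i. i \<in> {1..n} \<Longrightarrow> \<exists>e\<in>{1, -1}.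
         inv\<^bsub>PSL2R\<^esub> (\<sigma> i) \<otimes>\<^bsub>PSL2R\<^esub> S i \<otimes>\<^bsub>PSL2R\<^esub> \<sigma> i = real_moebius 1 e 0 1"
    and expansion: "\<And>i x. i \<in> {1..n-1} \<Longrightarrow> x \<in> upper_half_plane \<Longrightarrow>
        ((\<lambda>k. a i k * cusp_q x powi k) has_sum
           (J (the (\<sigma> i (Some x))) - the (puncture n w i))) {1..}"
    and expansion_infinity: "\<And>x. x \<in> upper_half_plane \<Longrightarrow>
        ((\<lambda>k. a n k * cusp_q x powi k) has_sum J (the (\<sigma> n (Some x)))) {-1..}"

text \<open>Here \<open>a w i k\<close> is the \<open>k\<close>-th coefficient at the \<open>i\<close>-th cusp, over the point \<open>w\<close>.\<close>

definition cusp_h ::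
    "nat \<Rightarrow> ((nat \<Rightarrow> complex) \<Rightarrow> nat \<Rightarrow> int \<Rightarrow> complex) \<Rightarrow> nat \<Rightarrow> (nat \<Rightarrow> complex) \<Rightarrow> real" where
  "cusp_h n a i w = (if i = n then (cmod (a w n (-1)))\<^sup>2 else (cmod (a w i 1))\<^sup>2)"

definition transposition_factor :: "nat \<Rightarrow> nat \<Rightarrow> (nat \<Rightarrow> complex) \<Rightarrow> complex" where
  "transposition_factor n k w =
     (if k = n - 1 then \<Prod>i\<in>{1..n-3}. (w i - 1)\<^sup>2
      else if k = n - 2 then \<Prod>i\<in>{1..n-3}. (w i)\<^sup>2
      else \<Prod>i\<in>{1..n-3} - {k}. (w i - w k)\<^sup>2 / (w k * (w k - 1)))"

text \<open>The values prescribed on the transpositions \<open>(k n)\<close> extend to a 1-cocycle when \<open>n\<close> is even.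
  For odd \<open>n\<close> they are compatible only up to sign: already for \<open>n = 5\<close> the relation
  $((3\,5)(1\,5))^3 = 1$ yields the factor \<open>-1\<close>. The cocycle relation is therefore required up to a
  constant sign, so that the family exists for every \<open>n > 3\<close>. The modulus of \<open>f p\<close>, and with it the
  condition on Hermitian metrics, does not depend on the signs. The lemma
  \<open>bundle_cocycle_of_cocycle\<close> below says that every 1-cocycle proper is included.\<close>

definition bundle_cocycle ::
    "nat \<Rightarrow> ((nat \<Rightarrow> nat) \<Rightarrow> (nat \<Rightarrow> complex) \<Rightarrow> complex) \<Rightarrow> bool" where
  "bundle_cocycle n f \<longleftrightarrow>
     (\<forall>k\<in>{1..n-1}. \<forall>w\<in>moduli n. f (Transposition.transpose k n) w = transposition_factor n k w) \<and>
     (\<forall>p\<^sub>1 p\<^sub>2. p\<^sub>1 permutes {1..n} \<longrightarrow> p\<^sub>2 permutes {1..n} \<longrightarrow>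
        (\<exists>\<epsilon>\<in>{1, -1}. \<forall>w\<in>moduli n. f (p\<^sub>1 \<circ> p\<^sub>2) w = \<epsilon> * (f p\<^sub>1 (symm_act n p\<^sub>2 w) * f p\<^sub>2 w)))"

lemma bundle_cocycle_of_cocycle:
  assumes "\<And>k w. k \<in> {1..n-1} \<Longrightarrow> w \<in> moduli n \<Longrightarrow>
      f (Transposition.transpose k n) w = transposition_factor n k w"
    and "\<And>p\<^sub>1 p\<^sub>2 w. p\<^sub>1 permutes {1..n} \<Longrightarrow> p\<^sub>2 permutes {1..n} \<Longrightarrow> w \<in> moduli n \<Longrightarrow>
      f (p\<^sub>1 \<circ> p\<^sub>2) w = f p\<^sub>1 (symm_act n p\<^sub>2 w) * f p\<^sub>2 w"
  shows "bundle_cocycle n f"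
  using assms unfolding bundle_cocycle_def by auto

definition determines_hermitian_metric ::
    "nat \<Rightarrow> ((nat \<Rightarrow> nat) \<Rightarrow> (nat \<Rightarrow> complex) \<Rightarrow> complex) \<Rightarrow> ((nat \<Rightarrow> complex) \<Rightarrow> real) \<Rightarrow> bool" where
  "determines_hermitian_metric n f H \<longleftrightarrow>
     smooth_on_moduli n H \<and> (\<forall>w\<in>moduli n. H w > 0) \<and>
     (\<forall>p. p permutes {1..n} \<longrightarrow>
        (\<forall>w\<in>moduli n. H (symm_act n p w) * (cmod (f p w))\<^sup>2 = H w))"

end

theory Submission
  imports Defs "HOL-Complex_Analysis.Conformal_Mappings"
begin

text \<open>
  Let $b_i$ be the first Taylor coefficient, in $q$, of $J \circ \sigma_i$ read in a coordinate of
  the sphere that vanishes at the $i$-th puncture: $\zeta - w_i$ at a finite puncture and $1/\zeta$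
  at infinity. Then $b_i = a_i(1)$ for $i < n$ and $b_n = 1/a_n(-1)$, so that
  $H = \prod_{i=1}^{n} |b_i|^2$: in these terms infinity is a puncture like any other, and the
  behaviour of \<open>H\<close> under relabelling is the chain rule.

  The point is that $|b_i|$ is intrinsic: it depends only on the punctured sphere, its \<open>i\<close>-th
  puncture and the coordinate there, and not on the uniformization. Let \<open>m\<close> be a Moebius map between
  the punctured spheres of two points \<open>w\<close> and \<open>v\<close>. Lifting \<open>m \<circ> J \<circ> \<sigma>\<^sub>i\<close> through the covering of the
  second sphere, composed with its scaling transformation, gives a holomorphic self-map \<open>F\<close> of the
  half-plane with $F(it) = it + c + o(1)$ as $t \to \infty$, where $e^{2\pi i c}$ is the ratio of the
  two coefficients, corrected by the derivative of \<open>m\<close>. By the Schwarz-Pick lemma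
  $\mathrm{Im}\, F(it)/t$ is nonincreasing; since it tends to 1, $\mathrm{Im}\, F(it) \ge t$ and the
  ratio has modulus at most 1 (\<open>cusp_coefficient_le\<close>). Exchanging the roles of the two spheres gives
  equality (\<open>leading_coeff_transform\<close>).

  For the transposition \<open>(k n)\<close> the Moebius map has the form $e + \delta/(\zeta - w_k)$ and
  its derivatives in the coordinates multiply to a number of modulus $1/|f_{(k\,n)}|$
  (\<open>prod_swap_multiplier\<close>). These transpositions generate the symmetric group, and the
  transformation law passes to products by the cocycle relation, whose sign the modulus removes.

  Positivity of \<open>H\<close> needs $b_i \ne 0, \infty$. At the last cusp $J \to \infty$, so that
  $a_n(-1) \ne 0$. At another cusp \<open>i\<close>, take a logarithm \<open>L\<close> of $J - w_i$ on the half-plane. Applying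
  $S_j$ adds to \<open>L\<close> the number $2\pi i$ times, up to sign, the order of $J - w_i$ at the cusp \<open>j\<close>:
  this order is some $m \ge 1$ for $j = i$, it is $-1$ for $j = n$ and $0$ otherwise. Now
  $S_1 \cdots S_n = 1$ forces $\pm m \pm 1 = 0$, hence $m = 1$
  (\<open>finite_cusp_coefficient_nonzero\<close>).
\<close>

section \<open>Smooth functions on the moduli space\<close>

text \<open>The moduli space is cut out by finitely many inequations on each coordinate, so a small move of one
  coordinate stays inside. Hence the partial derivatives at a point of the moduli space only see the
  values of a function there.\<close>

lemma eventually_moduli_coordinate_line:
  assumes "w \<in> moduli n" "j \<in> {1..n-3}"
  shows "eventually (\<lambda>t::real. w(j := w j + of_real t * u) \<in> moduli n) (nhds 0)"
proof -
  define A where "A = {0, 1} \<union> w ` ({1..n-3} - {j})"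
  have w: "w \<in> {1..n-3} \<rightarrow>\<^sub>E UNIV - {0, 1}" "inj_on w {1..n-3}"
    using assms(1) by (auto simp: moduli_def)
  have "w j \<notin> A"
    using w assms(2) by (auto simp: A_def inj_on_def)
  moreover have "open (- A)"
    by (intro open_Compl finite_imp_closed) (simp add: A_def)
  moreover have "((\<lambda>t::real. w j + of_real t * u) \<longlongrightarrow> w j + of_real 0 * u) (nhds 0)"
    by (intro tendsto_intros filterlim_ident)
  ultimately have "eventually (\<lambda>t::real. w j + of_real t * u \<in> - A) (nhds 0)"
    by (intro topological_tendstoD) auto
  then show ?thesis
  proof eventually_elim
    case (elim t)
    define v where "v = w(j := w j + of_real t * u)"
    have "v \<in> {1..n-3} \<rightarrow>\<^sub>E UNIV - {0, 1}"
      using w(1) elim assms(2) by (auto simp: v_def A_def PiE_iff extensional_def)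
    moreover have "inj_on v {1..n-3}"
    proof (rule inj_onI)
      have new: "v x \<noteq> v j" if "x \<in> {1..n-3}" "x \<noteq> j" for x
      proof -
        have "w x \<in> A" using that by (simp add: A_def)
        moreover have "v j \<notin> A" using elim by (simp add: v_def)
        moreover have "v x = w x" using that by (simp add: v_def)
        ultimately show ?thesis by metis
      qed
      fix x y assume "x \<in> {1..n-3}" "y \<in> {1..n-3}" "v x = v y"
      then show "x = y"
        using inj_onD[OF w(2), of x y] new[of x] new[of y]
        by (cases "x = j"; cases "y = j") (auto simp: v_def)
    qed
    ultimately show ?case
      by (simp add: moduli_def v_def)
  qed
qed

lemma coordinate_line_cong:
  assumes "\<And>v. v \<in> moduli n \<Longrightarrow> F v = G v" "w \<in> moduli n" "j \<in> {1..n-3}"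
  shows "eventually (\<lambda>t::real. F (w(j := w j + of_real t * u)) = G (w(j := w j + of_real t * u))) (nhds 0)"
  using eventually_moduli_coordinate_line[OF assms(2,3), of u]
  by eventually_elim (simp add: assms(1))

lemma partial_deriv_cong:
  assumes "\<And>v. v \<in> moduli n \<Longrightarrow> F v = G v" "w \<in> moduli n" "j \<in> {1..n-3}"
  shows "partial_deriv j u F w = partial_deriv j u G w"
  unfolding partial_deriv_def by (intro deriv_cong_ev refl coordinate_line_cong[of n F G] assms)

lemma coordinate_line_differentiable_cong:
  assumes "\<And>v. v \<in> moduli n \<Longrightarrow> F v = G v" "w \<in> moduli n" "j \<in> {1..n-3}"
  shows "(\<lambda>t::real. F (w(j := w j + of_real t * u))) differentiable at 0 \<longleftrightarrow>
         (\<lambda>t::real. G (w(j := w j + of_real t * u)) :: real) differentiable at 0"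
  unfolding real_differentiable_def
  by (intro ex_cong1 DERIV_cong_ev refl coordinate_line_cong[of n F G] assms)

lemma Ck_on_moduli_cong:
  assumes "\<And>v. v \<in> moduli n \<Longrightarrow> F v = G v"
  shows "Ck_on_moduli n k F \<longleftrightarrow> Ck_on_moduli n k G"
  using assms
proof (induction k arbitrary: F G)
  case 0
  then show ?case by (simp cong: continuous_on_cong)
next
  case (Suc k)
  have c: "continuous_on (moduli n) F \<longleftrightarrow> continuous_on (moduli n) G"
    using Suc.prems by (simp cong: continuous_on_cong)
  have d: "(\<lambda>t::real. F (w(j := w j + of_real t * u))) differentiable at 0 \<longleftrightarrow>
           (\<lambda>t::real. G (w(j := w j + of_real t * u))) differentiable at 0"
    if "w \<in> moduli n" "j \<in> {1..n-3}" for w j u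
    using coordinate_line_differentiable_cong[of n F G w j u] Suc.prems that by blast
  have p: "Ck_on_moduli n k (partial_deriv j u F) \<longleftrightarrow> Ck_on_moduli n k (partial_deriv j u G)"
    if "j \<in> {1..n-3}" for j u
    by (intro Suc.IH partial_deriv_cong) (use Suc.prems that in auto)
  show ?case
    unfolding Ck_on_moduli.simps using c d p by blast
qed

lemma Ck_on_moduli_SucD: "Ck_on_moduli n (Suc k) F \<Longrightarrow> Ck_on_moduli n k F"
proof (induction k arbitrary: F)
  case (Suc k)
  show ?case
    unfolding Ck_on_moduli.simps(2)[of n k]
    using Suc.prems Suc.IH unfolding Ck_on_moduli.simps(2)[of n "Suc k"] by blast
qed simp

lemma has_partial_deriv:
  assumes "Ck_on_moduli n (Suc k) F" "w \<in> moduli n" "j \<in> {1..n-3}" "u \<in> {1, \<i>}"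
  shows "((\<lambda>t::real. F (w(j := w j + of_real t * u))) has_real_derivative partial_deriv j u F w) (at 0)"
  using assms unfolding Ck_on_moduli.simps partial_deriv_def
  by (subst DERIV_deriv_iff_real_differentiable) blast

text \<open>The rules of calculus compute partial derivatives only at points of the moduli space. This rule
  therefore accepts any family \<open>D\<close> that agrees there with the partial derivatives.\<close>

lemma Ck_on_moduli_SucI:
  assumes "continuous_on (moduli n) F"
    and "\<And>j u w. j \<in> {1..n-3} \<Longrightarrow> u \<in> {1, \<i>} \<Longrightarrow> w \<in> moduli n \<Longrightarrow>
      ((\<lambda>t::real. F (w(j := w j + of_real t * u))) has_real_derivative D j u w) (at 0)"
    and "\<And>j u. j \<in> {1..n-3} \<Longrightarrow> u \<in> {1, \<i>} \<Longrightarrow> Ck_on_moduli n k (D j u)"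
  shows "Ck_on_moduli n (Suc k) F"
proof -
  have "Ck_on_moduli n k (partial_deriv j u F)" if "j \<in> {1..n-3}" "u \<in> {1, \<i>}" for j u
  proof -
    have "partial_deriv j u F w = D j u w" if "w \<in> moduli n" for w
      unfolding partial_deriv_def
      by (rule DERIV_imp_deriv[OF assms(2)]) fact+
    then show ?thesis
      using Ck_on_moduli_cong[of n "partial_deriv j u F" "D j u" k] assms(3) that by simp
  qed
  then show ?thesis
    using assms(1,2) unfolding Ck_on_moduli.simps real_differentiable_def by blast
qed

lemma Ck_on_moduli_const: "Ck_on_moduli n k (\<lambda>_. c)"
proof (induction k arbitrary: c)
  case (Suc k)
  show ?case
    by (rule Ck_on_moduli_SucI[where D = "\<lambda>_ _ _. 0"]) (auto intro: Suc.IH)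
qed simp

lemma Ck_on_moduli_add:
  "Ck_on_moduli n k F \<Longrightarrow> Ck_on_moduli n k G \<Longrightarrow> Ck_on_moduli n k (\<lambda>w. F w + G w)"
proof (induction k arbitrary: F G)
  case (Suc k)
  show ?case
  proof (rule Ck_on_moduli_SucI)
    fix j u w assume *: "j \<in> {1..n-3}" "u \<in> {1, \<i>}" "w \<in> moduli n"
    show "((\<lambda>t::real. F (w(j := w j + of_real t * u)) + G (w(j := w j + of_real t * u)))
       has_real_derivative partial_deriv j u F w + partial_deriv j u G w) (at 0)"
      by (intro DERIV_add has_partial_deriv[OF Suc.prems(1)] has_partial_deriv[OF Suc.prems(2)] *)
  qed (use Suc in \<open>auto intro!: continuous_intros\<close>)
qed (auto intro!: continuous_intros)

lemma Ck_on_moduli_mult: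
  "Ck_on_moduli n k F \<Longrightarrow> Ck_on_moduli n k G \<Longrightarrow> Ck_on_moduli n k (\<lambda>w. F w * G w)"
proof (induction k arbitrary: F G)
  case (Suc k)
  show ?case
  proof (rule Ck_on_moduli_SucI)
    fix j u w assume *: "j \<in> {1..n-3}" "u \<in> {1, \<i>}" "w \<in> moduli n"
    show "((\<lambda>t::real. F (w(j := w j + of_real t * u)) * G (w(j := w j + of_real t * u)))
       has_real_derivative partial_deriv j u F w * G w + F w * partial_deriv j u G w) (at 0)"
      by (rule DERIV_cong[OF DERIV_mult[OF has_partial_deriv[OF Suc.prems(1) *(3,1,2)]
            has_partial_deriv[OF Suc.prems(2) *(3,1,2)]]]) (simp add: algebra_simps)
  next
    fix j u assume *: "j \<in> {1..n-3}" "u \<in> {1::complex, \<i>}"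
    then have "Ck_on_moduli n k (partial_deriv j u F)" "Ck_on_moduli n k (partial_deriv j u G)"
      using Suc.prems by auto
    then show "Ck_on_moduli n k (\<lambda>w. partial_deriv j u F w * G w + F w * partial_deriv j u G w)"
      using Suc.IH Suc.prems[THEN Ck_on_moduli_SucD] by (intro Ck_on_moduli_add) auto
  qed (use Suc.prems in \<open>auto intro!: continuous_intros\<close>)
qed (auto intro!: continuous_intros)

lemma Ck_on_moduli_inverse:
  assumes "\<And>w. w \<in> moduli n \<Longrightarrow> F w \<noteq> 0"
  shows "Ck_on_moduli n k F \<Longrightarrow> Ck_on_moduli n k (\<lambda>w. inverse (F w))"
proof (induction k)
  case 0
  then show ?case using assms by (auto intro!: continuous_intros)
next
  case (Suc k)
  show ?case
  proof (rule Ck_on_moduli_SucI)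
    fix j u w assume *: "j \<in> {1..n-3}" "u \<in> {1, \<i>}" "w \<in> moduli n"
    show "((\<lambda>t::real. inverse (F (w(j := w j + of_real t * u)))) has_real_derivative
        (-1) * (partial_deriv j u F w * (inverse (F w) * inverse (F w)))) (at 0)"
      by (rule DERIV_cong[OF DERIV_inverse'[OF has_partial_deriv[OF Suc.prems *(3,1,2)]]])
        (use assms[OF *(3)] in \<open>simp_all add: algebra_simps\<close>)
  next
    fix j u assume *: "j \<in> {1..n-3}" "u \<in> {1::complex, \<i>}"
    then have "Ck_on_moduli n k (partial_deriv j u F)"
      using Suc.prems by auto
    then show "Ck_on_moduli n k (\<lambda>w. (-1) * (partial_deriv j u F w * (inverse (F w) * inverse (F w))))"
      using Suc.IH Suc.prems[THEN Ck_on_moduli_SucD]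
      by (intro Ck_on_moduli_mult Ck_on_moduli_const) auto
  qed (use Suc.prems assms in \<open>auto intro!: continuous_intros\<close>)
qed

lemma smooth_on_moduli_prod:
  assumes "finite I" "\<And>i. i \<in> I \<Longrightarrow> smooth_on_moduli n (F i)"
  shows "smooth_on_moduli n (\<lambda>w. \<Prod>i\<in>I. F i w)"
  using assms
proof (induction I rule: finite_induct)
  case empty
  then show ?case by (simp add: smooth_on_moduli_def Ck_on_moduli_const)
next
  case (insert i I)
  then show ?case by (simp add: smooth_on_moduli_def Ck_on_moduli_mult)
qed

lemma smooth_on_moduli_divide:
  assumes "smooth_on_moduli n F" "smooth_on_moduli n G" "\<And>w. w \<in> moduli n \<Longrightarrow> G w \<noteq> 0"
  shows "smooth_on_moduli n (\<lambda>w. F w / G w)"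
  using assms unfolding smooth_on_moduli_def divide_inverse
  by (auto intro!: Ck_on_moduli_mult Ck_on_moduli_inverse)

section \<open>Holomorphic self-maps of the half-plane and coefficients at a cusp\<close>

lemma open_upper_half_plane: "open upper_half_plane"
  by (simp add: upper_half_plane_def open_halfspace_Im_gt)

lemma convex_upper_half_plane: "convex upper_half_plane"
  by (simp add: upper_half_plane_def convex_halfspace_Im_gt)

text \<open>A point of the half-plane is nearer to \<open>b\<close> than to the mirror image of \<open>b\<close>: this is why
  \<open>(z - b) / (z - cnj b)\<close> maps the half-plane into the unit disc.\<close>

lemma upper_half_plane_reflection_less:
  assumes "Im z > 0" "Im b > 0"
  shows "cmod (z - b) < cmod (z - cnj b)"
proof -
  have "(cmod (z - b))\<^sup>2 < (cmod (z - cnj b))\<^sup>2"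
    using mult_pos_pos[OF assms] unfolding cmod_power2
    by (simp add: power2_eq_square algebra_simps)
  then show ?thesis
    by (rule power2_less_imp_less) simp
qed

text \<open>A holomorphic self-map does not increase the hyperbolic distance. The points \<open>\<i>s\<close> and \<open>\<i>t\<close>
  have distance \<open>ln (t / s)\<close>, and the distance of any two points is at least the logarithm of the ratio
  of their imaginary parts. So \<open>Im (F (\<i>t)) / t\<close> is nonincreasing. The proof carries \<open>F\<close> to the disc,
  centred at \<open>\<i>s\<close> and \<open>F (\<i>s)\<close>, where the Schwarz lemma applies.\<close>

lemma Schwarz_Pick_imaginary_axis:
  assumes holF: "F holomorphic_on upper_half_plane"
    and F: "F \<in> upper_half_plane \<rightarrow> upper_half_plane"
    and st: "0 < s" "s \<le> t"
  shows "Im (F (\<i> * of_real t)) * s \<le> t * Im (F (\<i> * of_real s))"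
proof -
  define b where "b = F (\<i> * of_real s)"
  \<comment> \<open>The Cayley map of the disc onto the half-plane that takes 0 to \<open>\<i>s\<close>.\<close>
  define C where "C \<zeta> = \<i> * of_real s * ((1 + \<zeta>) / (1 - \<zeta>))" for \<zeta> :: complex
  define g where "g \<zeta> = (F (C \<zeta>) - b) / (F (C \<zeta>) - cnj b)" for \<zeta>
  have FH: "Im (F x) > 0" if "Im x > 0" for x
    using F that by (auto simp: upper_half_plane_def)
  have b: "Im b > 0"
    unfolding b_def using st by (intro FH) simp
  have C: "Im (C \<zeta>) > 0" if "cmod \<zeta> < 1" for \<zeta>
  proof -
    have "\<zeta> \<noteq> 1" using that by auto
    then have "1 - \<zeta> \<noteq> 0" by simp
    then have pos: "(Re (1 - \<zeta>))\<^sup>2 + (Im (1 - \<zeta>))\<^sup>2 > 0"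
      by (metis complex_eq_iff sum_power2_gt_zero_iff zero_complex.sel)
    have "Re ((1 + \<zeta>) / (1 - \<zeta>)) =
        (1 - ((Re \<zeta>)\<^sup>2 + (Im \<zeta>)\<^sup>2)) / ((Re (1 - \<zeta>))\<^sup>2 + (Im (1 - \<zeta>))\<^sup>2)"
      by (simp add: Re_divide power2_eq_square algebra_simps)
    moreover have "(Re \<zeta>)\<^sup>2 + (Im \<zeta>)\<^sup>2 < 1"
      using that by (simp add: cmod_def)
    ultimately have "Re ((1 + \<zeta>) / (1 - \<zeta>)) > 0"
      using pos by simp
    moreover have "Im (\<i> * of_real s * X) = s * Re X" for X
      by simp
    ultimately show ?thesis
      using st by (simp only: C_def mult_pos_pos)
  qed
  have ne: "F (C \<zeta>) - cnj b \<noteq> 0" if "cmod \<zeta> < 1" for \<zeta>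
  proof
    assume "F (C \<zeta>) - cnj b = 0"
    then have "Im (F (C \<zeta>)) = - Im b" by (simp add: complex_eq_iff)
    with FH[OF C[OF that]] b show False by simp
  qed
  have holC: "C holomorphic_on ball 0 1"
    unfolding C_def by (intro holomorphic_intros) auto
  have "(F \<circ> C) holomorphic_on ball 0 1"
    by (rule holomorphic_on_compose_gen[OF holC holF]) (use C in \<open>auto simp: upper_half_plane_def\<close>)
  then have holg: "g holomorphic_on ball 0 1"
    unfolding g_def o_def by (intro holomorphic_intros) (use ne in auto)
  have g0: "g 0 = 0"
    by (simp add: g_def C_def b_def)
  have g1: "cmod (g \<zeta>) < 1" if "cmod \<zeta> < 1" for \<zeta>
    using upper_half_plane_reflection_less[OF FH[OF C[OF that]] b] ne[OF that]
    by (simp add: g_def norm_divide)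
  \<comment> \<open>The point of the disc that \<open>C\<close> takes to \<open>\<i>t\<close>.\<close>
  define k where "k = (t - s) / (t + s)"
  have k: "0 \<le> k" "k < 1"
    using st by (auto simp: k_def)
  have "1 + k = 2 * t / (t + s)" "1 - k = 2 * s / (t + s)"
    using st by (simp_all add: k_def field_simps)
  then have "s * ((1 + k) / (1 - k)) = t"
    using st by simp
  moreover have "C (of_real k) = \<i> * of_real (s * ((1 + k) / (1 - k)))"
    by (simp add: C_def)
  ultimately have Ck: "C (of_real k) = \<i> * of_real t"
    by simp
  define z where "z = F (\<i> * of_real t)"
  have z: "Im z > 0"
    unfolding z_def using st by (intro FH) simp
  have "cmod (g (of_real k)) \<le> cmod (of_real k)"
    by (rule Schwarz_Lemma(1)[OF holg g0 g1]) (use k in auto)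
  then have "cmod (z - b) \<le> k * cmod (z - cnj b)"
    using k ne[of "of_real k"] by (simp add: g_def Ck norm_divide z_def divide_le_eq)
  then have "(t + s) * cmod (z - b) \<le> (t - s) * cmod (z - cnj b)"
    using st by (simp add: k_def field_simps)
  then have "((t + s) * cmod (z - b))\<^sup>2 \<le> ((t - s) * cmod (z - cnj b))\<^sup>2"
    by (rule power_mono) (use st in auto)
  then have "(t + s)\<^sup>2 * ((Re z - Re b)\<^sup>2 + (Im z - Im b)\<^sup>2)
      \<le> (t - s)\<^sup>2 * ((Re z - Re b)\<^sup>2 + (Im z + Im b)\<^sup>2)"
    by (simp add: power_mult_distrib cmod_power2)
  moreover have "(t - s)\<^sup>2 * (Re z - Re b)\<^sup>2 \<le> (t + s)\<^sup>2 * (Re z - Re b)\<^sup>2"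
    using st by (intro mult_right_mono power_mono) auto
  ultimately have "(t + s)\<^sup>2 * (Im z - Im b)\<^sup>2 \<le> (t - s)\<^sup>2 * (Im z + Im b)\<^sup>2"
    by (simp add: algebra_simps)
  then have "((t + s) * (Im z - Im b))\<^sup>2 \<le> ((t - s) * (Im z + Im b))\<^sup>2"
    by (simp add: power_mult_distrib)
  then have "(t + s) * (Im z - Im b) \<le> (t - s) * (Im z + Im b)"
    by (rule power2_le_imp_le) (use st z b in auto)
  then show ?thesis
    unfolding z_def b_def by (simp add: algebra_simps)
qed

lemma norm_cusp_q: "cmod (cusp_q x) = exp (- 2 * pi * Im x)"
  by (simp add: cusp_q_def norm_exp_eq_Re)

lemma cusp_q_nonzero: "cusp_q x \<noteq> 0"
  by (simp add: cusp_q_def)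

lemma cusp_q_in_disc: "x \<in> upper_half_plane \<Longrightarrow> cmod (cusp_q x) < 1"
  by (simp add: norm_cusp_q upper_half_plane_def)

lemma cusp_q_surj:
  assumes "q \<noteq> 0" "cmod q < 1"
  obtains x where "x \<in> upper_half_plane" "cusp_q x = q"
proof
  define x where "x = Ln q / (2 * of_real pi * \<i>)"
  show "cusp_q x = q"
    using assms by (simp add: x_def cusp_q_def)
  then have "exp (- 2 * pi * Im x) < 1"
    using assms(2) norm_cusp_q[of x] by simp
  then show "x \<in> upper_half_plane"
    by (simp add: upper_half_plane_def mult_less_0_iff zero_less_mult_iff)
qed

text \<open>Here \<open>K1\<close> is a covering map of a punctured surface, given through its lifting property, and \<open>K2\<close> is
  a map from the half-plane into the same surface. Both tend at infinity to one puncture, where \<open>\<tau>\<close> is a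
  coordinate; \<open>\<Phi>1\<close> and \<open>\<Phi>2\<close> describe the two maps in this coordinate as functions of \<open>q\<close>. A lift
  \<open>F\<close> of \<open>K2\<close> that begins near infinity satisfies \<open>cusp_q (F x) = \<psi> (cusp_q x)\<close> along the imaginary
  axis, with \<open>\<psi> = \<Phi>1\<inverse> \<circ> \<Phi>2\<close>. Monotonicity of \<open>Im (F (\<i>t)) / t\<close> gives \<open>Im (F (\<i>t)) \<ge> t\<close>, that is
  \<open>|\<psi> q| \<le> |q|\<close> for small positive \<open>q\<close>, and therefore \<open>|b2 / b1| = |\<psi>' 0| \<le> 1\<close>.\<close>

lemma cusp_coefficient_le:
  fixes K1 K2 \<tau> \<Phi>1 \<Phi>2 :: "complex \<Rightarrow> complex"
  assumes lift: "\<And>x y. x \<in> upper_half_plane \<Longrightarrow> y \<in> upper_half_plane \<Longrightarrow> K1 x = K2 y \<Longrightarrow>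
      \<exists>F. F holomorphic_on upper_half_plane \<and> F \<in> upper_half_plane \<rightarrow> upper_half_plane \<and>
        F y = x \<and> (\<forall>z\<in>upper_half_plane. K1 (F z) = K2 z)"
    and inj: "\<And>x y. x \<in> upper_half_plane \<Longrightarrow> y \<in> upper_half_plane \<Longrightarrow>
      \<tau> (K1 x) = \<tau> (K2 y) \<Longrightarrow> K1 x = K2 y"
    and K1: "\<And>x. x \<in> upper_half_plane \<Longrightarrow> \<tau> (K1 x) = \<Phi>1 (cusp_q x)"
    and K2: "\<And>x. x \<in> upper_half_plane \<Longrightarrow> \<tau> (K2 x) = \<Phi>2 (cusp_q x)"
    and hol1: "\<Phi>1 holomorphic_on U" and U: "open U" "0 \<in> U"
    and zero: "\<Phi>1 0 = 0" "\<Phi>2 0 = 0"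
    and deriv1: "(\<Phi>1 has_field_derivative b1) (at 0)" and b1: "b1 \<noteq> 0"
    and deriv2: "(\<Phi>2 has_field_derivative b2) (at 0)"
  shows "cmod b2 \<le> cmod b1"
proof (cases "b2 = 0")
  case False
  have "deriv \<Phi>1 0 = b1"
    using deriv1 by (rule DERIV_imp_deriv)
  then obtain r0 where r0: "r0 > 0" "ball 0 r0 \<subseteq> U" "inj_on \<Phi>1 (ball 0 r0)"
    using has_complex_derivative_locally_injective[OF hol1 U(2,1)] b1 by metis
  define r where "r = min r0 1"
  have r: "r > 0" "r \<le> 1" "ball 0 r \<subseteq> U" and injr: "inj_on \<Phi>1 (ball 0 r)"
    using r0 by (auto simp: r_def intro: inj_on_subset)
  have holr: "\<Phi>1 holomorphic_on ball 0 r"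
    using hol1 r holomorphic_on_subset by blast
  obtain g where g: "g holomorphic_on \<Phi>1 ` ball 0 r"
      "\<And>z. z \<in> ball 0 r \<Longrightarrow> deriv \<Phi>1 z * deriv g (\<Phi>1 z) = 1"
      "\<And>z. z \<in> ball 0 r \<Longrightarrow> g (\<Phi>1 z) = z"
    using holomorphic_has_inverse[OF holr _ injr] by auto
  have open_im: "open (\<Phi>1 ` ball 0 r)"
    by (rule open_mapping_thm3[OF holr _ injr]) simp
  have zero_im: "0 \<in> \<Phi>1 ` ball 0 r"
    using zero(1) r(1) by (metis centre_in_ball imageI)
  define \<psi> where "\<psi> q = g (\<Phi>2 q)" for q
  define \<rho> where "\<rho> = b2 / b1"
  have "deriv g 0 = 1 / b1"
    using g(2)[of 0] r(1) zero(1) \<open>deriv \<Phi>1 0 = b1\<close> b1 by (simp add: field_simps)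
  moreover have "(g has_field_derivative deriv g 0) (at (\<Phi>2 0))"
    using holomorphic_derivI[OF g(1) open_im zero_im] zero by simp
  ultimately have d\<psi>: "(\<psi> has_field_derivative \<rho>) (at 0)"
    using DERIV_chain2[of g "1 / b1" \<Phi>2 0 b2 UNIV] deriv2
    by (simp add: \<psi>_def[abs_def] \<rho>_def mult.commute)
  have \<psi>0: "\<psi> 0 = 0"
    using g(3)[of 0] r zero by (simp add: \<psi>_def)
  have lim: "((\<lambda>q. \<psi> q / q) \<longlongrightarrow> \<rho>) (at 0)"
    using d\<psi> \<psi>0 by (simp add: has_field_derivative_iff)
  define C where "C = cmod \<rho> + 1"
  have C: "C > 0" by (simp add: C_def add_nonneg_pos)
  have "eventually (\<lambda>q. cmod (\<psi> q / q) < C) (at 0)"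
    using tendsto_norm[OF lim] by (rule order_tendstoD) (simp add: C_def)
  moreover have "eventually (\<lambda>q. \<Phi>2 q \<in> \<Phi>1 ` ball 0 r) (at 0)"
    using DERIV_isCont[OF deriv2] open_im zero_im zero(2)
    unfolding isCont_def by (metis topological_tendstoD)
  moreover have "eventually (\<lambda>q. \<Phi>2 q / q \<noteq> 0) (at 0)"
  proof -
    have "((\<lambda>q. \<Phi>2 q / q) \<longlongrightarrow> b2) (at 0)"
      using deriv2 zero by (simp add: has_field_derivative_iff)
    then show ?thesis
      using False by (rule tendsto_imp_eventually_ne)
  qed
  ultimately have "eventually (\<lambda>q. cmod (\<psi> q / q) < C \<and> \<Phi>2 q \<in> \<Phi>1 ` ball 0 r \<and> \<Phi>2 q / q \<noteq> 0) (at 0)"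
    by eventually_elim auto
  then obtain \<delta>0 where \<delta>0: "\<delta>0 > 0"
      "\<And>q. q \<noteq> 0 \<Longrightarrow> cmod q < \<delta>0 \<Longrightarrow> cmod (\<psi> q / q) < C \<and> \<Phi>2 q \<in> \<Phi>1 ` ball 0 r \<and> \<Phi>2 q / q \<noteq> 0"
    unfolding eventually_at by auto
  \<comment> \<open>This choice keeps \<open>\<psi> q\<close> in the disc of radius \<open>r / 2\<close>, well inside the disc where \<open>\<Phi>1\<close> is injective.\<close>
  define \<delta> where "\<delta> = min \<delta>0 (r / (2 * C))"
  have \<delta>: "\<delta> > 0" using \<delta>0(1) r(1) C by (simp add: \<delta>_def)
  have \<psi>C: "cmod (\<psi> q) \<le> C * cmod q" and \<psi>r: "cmod (\<psi> q) < r / 2"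
    and \<psi>\<Phi>: "\<Phi>1 (\<psi> q) = \<Phi>2 q" and \<psi>ne: "\<psi> q \<noteq> 0" if "q \<noteq> 0" "cmod q < \<delta>" for q
  proof -
    have *: "cmod (\<psi> q / q) < C" "\<Phi>2 q \<in> \<Phi>1 ` ball 0 r" "\<Phi>2 q / q \<noteq> 0"
      using \<delta>0(2)[of q] that by (auto simp: \<delta>_def)
    show c: "cmod (\<psi> q) \<le> C * cmod q"
      using *(1) that by (simp add: norm_divide divide_less_eq)
    have "C * cmod q < C * (r / (2 * C))"
      using that C by (intro mult_strict_left_mono) (auto simp: \<delta>_def)
    then show "cmod (\<psi> q) < r / 2"
      using c C by simp
    show eq: "\<Phi>1 (\<psi> q) = \<Phi>2 q"
      using *(2) g(3) by (auto simp: \<psi>_def)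
    show "\<psi> q \<noteq> 0"
      using eq *(3) zero by auto
  qed
  define Q where "Q t = cusp_q (\<i> * of_real t)" for t :: real
  have Q: "cmod (Q t) = exp (- 2 * pi * t)" "Q t \<noteq> 0" for t
    by (simp_all add: Q_def norm_cusp_q cusp_q_nonzero)
  have "((\<lambda>t. exp (- 2 * pi * t)) \<longlongrightarrow> 0) at_top"
    by (intro filterlim_compose[OF exp_at_bot]
          filterlim_tendsto_neg_mult_at_bot[OF tendsto_const _ filterlim_ident]) simp
  then have lim0: "((\<lambda>t. cmod (Q t)) \<longlongrightarrow> 0) at_top"
    by (simp add: Q)
  obtain t0 where t0: "t0 > 0" "\<And>t. t \<ge> t0 \<Longrightarrow> cmod (Q t) < \<delta>"
  proof -
    have "eventually (\<lambda>t. cmod (Q t) < \<delta>) at_top"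
      using lim0 \<delta> by (rule order_tendstoD)
    then obtain T where "\<And>t. t \<ge> T \<Longrightarrow> cmod (Q t) < \<delta>"
      unfolding eventually_at_top_linorder by auto
    then show ?thesis by (intro that[of "max T 1"]) auto
  qed
  have axis: "\<i> * of_real t \<in> upper_half_plane" if "t > 0" for t
    using that by (simp add: upper_half_plane_def)
  note \<psi>Q = \<psi>C[OF Q(2) t0(2)] \<psi>r[OF Q(2) t0(2)] \<psi>\<Phi>[OF Q(2) t0(2)] \<psi>ne[OF Q(2) t0(2)]
  obtain x0 where x0: "x0 \<in> upper_half_plane" "cusp_q x0 = \<psi> (Q t0)"
  proof -
    have "cmod (\<psi> (Q t0)) < 1" using \<psi>Q(2)[of t0] r by simp
    then show ?thesis using cusp_q_surj[OF \<psi>Q(4)[of t0]] that by blast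
  qed
  have "K1 x0 = K2 (\<i> * of_real t0)"
    using x0 axis[OF t0(1)] \<psi>Q(3)[of t0] by (intro inj) (simp_all add: K1 K2 Q_def)
  then obtain F where F: "F holomorphic_on upper_half_plane" "F \<in> upper_half_plane \<rightarrow> upper_half_plane"
      "F (\<i> * of_real t0) = x0" "\<And>z. z \<in> upper_half_plane \<Longrightarrow> K1 (F z) = K2 z"
    using lift[OF x0(1) axis[OF t0(1)]] by blast
  define E where "E t = cusp_q (F (\<i> * of_real t))" for t
  have contE: "continuous_on {t0..} (\<lambda>t. cmod (E t))"
  proof -
    have "continuous_on {t0..} (\<lambda>t. F (\<i> * of_real t))"
      by (rule continuous_on_compose2[OF holomorphic_on_imp_continuous_on[OF F(1)]])
        (use t0(1) axis in \<open>auto intro!: continuous_intros\<close>)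
    then show ?thesis
      unfolding E_def cusp_q_def by (intro continuous_intros)
  qed
  have E\<Phi>: "\<Phi>1 (E t) = \<Phi>2 (Q t)" if "t \<ge> t0" for t
  proof -
    have t: "\<i> * of_real t \<in> upper_half_plane" using that t0(1) by (intro axis) simp
    then have "F (\<i> * of_real t) \<in> upper_half_plane" using F(2) by blast
    then show ?thesis
      using K1[of "F (\<i> * of_real t)"] K2[OF t] F(4)[OF t] by (simp add: E_def Q_def)
  qed
  have E_small: "E t = \<psi> (Q t)" if "t \<ge> t0" "cmod (E t) < r" for t
  proof (rule inj_onD[OF injr])
    show "\<Phi>1 (E t) = \<Phi>1 (\<psi> (Q t))"
      using E\<Phi>[OF that(1)] \<psi>Q(3)[OF that(1)] by simp
  qed (use that \<psi>Q(2)[OF that(1)] r in auto)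
  \<comment> \<open>Wherever \<open>|E| < r\<close>, injectivity of \<open>\<Phi>1\<close> gives \<open>E = \<psi> \<circ> Q\<close> and so \<open>|E| < r / 2\<close>. As \<open>|E|\<close>
    begins below \<open>r / 2\<close> and is continuous, it never crosses the gap.\<close>
  have E_eq: "E t = \<psi> (Q t)" if t: "t \<ge> t0" for t
  proof (rule E_small[OF t], rule ccontr)
    assume "\<not> cmod (E t) < r"
    moreover have "cmod (E t0) < r / 2"
      using F(3) x0(2) \<psi>Q(2)[of t0] by (simp add: E_def)
    ultimately obtain t' where t': "t0 \<le> t'" "t' \<le> t" "cmod (E t') = 3 * r / 4"
      using IVT'[of "\<lambda>t. cmod (E t)" t0 "3 * r / 4" t] t r(1) continuous_on_subset[OF contE, of "{t0..t}"]
      by auto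
    then have "cmod (E t') < r / 2"
      using E_small[of t'] \<psi>Q(2)[of t'] r(1) by simp
    with t' r(1) show False by simp
  qed
  have normE: "cmod (E t) = exp (- 2 * pi * Im (F (\<i> * of_real t)))" for t
    by (simp add: E_def norm_cusp_q)
  define c where "c = ln C / (2 * pi)"
  have lower: "Im (F (\<i> * of_real t)) \<ge> t - c" if "t \<ge> t0" for t
  proof -
    have "exp (- 2 * pi * Im (F (\<i> * of_real t))) \<le> C * exp (- 2 * pi * t)"
      using \<psi>Q(1)[OF that] E_eq[OF that] normE[of t] Q by simp
    also have "\<dots> = exp (ln C - 2 * pi * t)"
      using C by (simp add: exp_diff exp_minus divide_inverse)
    finally have "2 * pi * (t - Im (F (\<i> * of_real t))) \<le> ln C"
      by (simp add: algebra_simps)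
    then show ?thesis
      by (simp add: c_def field_simps)
  qed
  have ge: "Im (F (\<i> * of_real t)) \<ge> t" if "t \<ge> t0" for t
  proof (rule ccontr)
    define d where "d = t - Im (F (\<i> * of_real t))"
    assume "\<not> ?thesis"
    then have d: "d > 0" by (simp add: d_def)
    \<comment> \<open>If \<open>Im (F (\<i>t)) = t - d\<close>, monotonicity gives \<open>Im (F (\<i>T)) \<le> T - T d / t\<close>, which is less than \<open>T - c\<close>
      for large \<open>T\<close>.\<close>
    define T where "T = max t (c * t / d + 1)"
    have T: "T \<ge> t" "T * d > c * t"
      using d by (auto simp: T_def max_def field_simps)
    have "(T - c) * t \<le> Im (F (\<i> * of_real T)) * t"
      using lower[of T] T that t0 by (intro mult_right_mono) auto
    also have "\<dots> \<le> T * Im (F (\<i> * of_real t))"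
      using T that t0 by (intro Schwarz_Pick_imaginary_axis F) auto
    finally have "T * d \<le> c * t"
      by (simp add: d_def algebra_simps)
    with T show False by simp
  qed
  have bound: "cmod (\<psi> (Q t) / Q t) \<le> 1" if "t \<ge> t0" for t
  proof -
    have "cmod (\<psi> (Q t)) \<le> cmod (Q t)"
      using ge[OF that] E_eq[OF that] normE[of t] Q by simp
    then show ?thesis
      using Q(2)[of t] by (simp add: norm_divide divide_le_eq)
  qed
  have "filterlim Q (at 0) at_top"
    using lim0 Q(2) unfolding filterlim_at by (auto simp: tendsto_norm_zero_iff)
  then have "((\<lambda>t. cmod (\<psi> (Q t) / Q t)) \<longlongrightarrow> cmod \<rho>) at_top"
    by (intro tendsto_norm filterlim_compose[OF lim])
  then have "cmod \<rho> \<le> 1"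
    by (rule tendsto_upperbound) (use bound in \<open>auto simp: eventually_at_top_linorder\<close>)
  then show ?thesis
    using b1 by (simp add: \<rho>_def norm_divide divide_le_eq)
qed simp

section \<open>Moebius transformations\<close>

text \<open>The determinant condition on the inner map says that its numerator and denominator do not vanish
  together, so that a zero of the denominator really is a pole.\<close>

lemma moebius_compose:
  assumes "a' * d' - b' * c' \<noteq> 0"
  shows "moebius a b c d (moebius a' b' c' d' x) =
    moebius (a * a' + b * c') (a * b' + b * d') (c * a' + d * c') (c * b' + d * d') x"
proof (cases x)
  case None
  show ?thesis
  proof (cases "c' = 0")
    case True
    then have "a' \<noteq> 0" using assms by auto
    with True None show ?thesis by (simp add: moebius_def)
  next
    case False
    have "c * (a' / c') + d = (c * a' + d * c') / c'" "a * (a' / c') + b = (a * a' + b * c') / c'"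
      using False by (simp_all add: field_simps)
    with False None show ?thesis by (simp add: moebius_def)
  qed
next
  case (Some z)
  define N D where "N = a' * z + b'" and "D = c' * z + d'"
  have num: "(a * a' + b * c') * z + (a * b' + b * d') = a * N + b * D"
    and den: "(c * a' + d * c') * z + (c * b' + d * d') = c * N + d * D"
    by (simp_all add: N_def D_def algebra_simps)
  show ?thesis
  proof (cases "D = 0")
    case True
    have "N \<noteq> 0"
    proof
      assume "N = 0"
      have "(a' * d' - b' * c') = a' * D - c' * N"
        by (simp add: N_def D_def algebra_simps)
      with \<open>N = 0\<close> True assms show False by simp
    qed
    with True Some num den show ?thesis
      by (simp add: moebius_def N_def[symmetric] D_def[symmetric])
  next
    case False
    have "c * (N / D) + d = (c * N + d * D) / D" "a * (N / D) + b = (a * N + b * D) / D"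
      using False by (simp_all add: field_simps)
    with False Some num den show ?thesis
      by (simp add: moebius_def N_def[symmetric] D_def[symmetric])
  qed
qed

lemma moebius_scalar: "a \<noteq> 0 \<Longrightarrow> moebius a 0 0 a = id"
  by (auto simp: moebius_def fun_eq_iff split: option.split)

lemma moebius_inverse:
  assumes "a * d - b * c \<noteq> 0"
  shows "moebius d (-b) (-c) a (moebius a b c d x) = x"
    and "moebius a b c d (moebius d (-b) (-c) a x) = x"
  using assms moebius_scalar[of "a * d - b * c"]
  by (simp_all add: moebius_compose algebra_simps)

lemma Moebius_maps_comp:
  assumes "M \<in> Moebius_maps" "M' \<in> Moebius_maps"
  shows "M \<circ> M' \<in> Moebius_maps"
proof -
  obtain a b c d where M: "M = moebius a b c d" "a * d - b * c \<noteq> 0"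
    using assms(1) by (auto simp: Moebius_maps_def)
  obtain a' b' c' d' where M': "M' = moebius a' b' c' d'" "a' * d' - b' * c' \<noteq> 0"
    using assms(2) by (auto simp: Moebius_maps_def)
  have "(a * a' + b * c') * (c * b' + d * d') - (a * b' + b * d') * (c * a' + d * c') =
      (a * d - b * c) * (a' * d' - b' * c')"
    by (simp add: algebra_simps)
  moreover have "M \<circ> M' =
      moebius (a * a' + b * c') (a * b' + b * d') (c * a' + d * c') (c * b' + d * d')"
    using M M' by (simp add: fun_eq_iff moebius_compose)
  ultimately show ?thesis
    unfolding Moebius_maps_def using M(2) M'(2) by (smt (verit, best) mem_Collect_eq mult_eq_0_iff)
qed

lemma Moebius_maps_inverse:
  assumes "M \<in> Moebius_maps"
  obtains N where "N \<in> Moebius_maps" "\<And>x. N (M x) = x" "\<And>x. M (N x) = x"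
proof -
  obtain a b c d where M: "M = moebius a b c d" "a * d - b * c \<noteq> 0"
    using assms by (auto simp: Moebius_maps_def)
  have "moebius d (-b) (-c) a \<in> Moebius_maps"
    unfolding Moebius_maps_def using M(2)
    by (intro CollectI exI[of _ d] exI[of _ "-b"] exI[of _ "-c"] exI[of _ a]) (simp add: mult.commute)
  with that show ?thesis
    using moebius_inverse[OF M(2)] M(1) by blast
qed

lemma Moebius_maps_fixing_0_1_infinity:
  assumes "M \<in> Moebius_maps" "M (Some 0) = Some 0" "M (Some 1) = Some 1" "M None = None"
  shows "M = id"
proof -
  obtain a b c d where M: "M = moebius a b c d" "a * d - b * c \<noteq> 0"
    using assms(1) by (auto simp: Moebius_maps_def)
  have "c = 0"
    using assms(4) M(1) by (auto simp: moebius_def split: if_splits)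
  moreover from this have "d \<noteq> 0" "a \<noteq> 0" using M(2) by auto
  moreover have "b = 0"
    using assms(2) M(1) \<open>c = 0\<close> \<open>d \<noteq> 0\<close> by (auto simp: moebius_def)
  moreover have "a = d"
    using assms(3) M(1) \<open>c = 0\<close> \<open>d \<noteq> 0\<close> \<open>b = 0\<close> by (auto simp: moebius_def)
  ultimately show ?thesis
    using M(1) by (simp add: moebius_scalar)
qed

text \<open>This makes the renormalization unique. The map \<open>M \<circ> M'\<inverse>\<close> fixes 0, 1 and infinity.\<close>

lemma Moebius_maps_eqI:
  assumes M: "M \<in> Moebius_maps" "M x = Some 0" "M y = Some 1" "M z = None"
    and M': "M' \<in> Moebius_maps" "M' x = Some 0" "M' y = Some 1" "M' z = None"
  shows "M = M'"
proof -
  obtain N where N: "N \<in> Moebius_maps" "\<And>x. N (M' x) = x" "\<And>x. M' (N x) = x"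
    using Moebius_maps_inverse[OF M'(1)] by blast
  have "N (Some 0) = x" "N (Some 1) = y" "N None = z"
    using N(2) M' by metis+
  then have "M \<circ> N = id"
    using M Moebius_maps_comp[OF M(1) N(1)] by (intro Moebius_maps_fixing_0_1_infinity) auto
  then have "M (N (M' v)) = M' v" for v
    by (metis comp_apply id_apply)
  with N(2) show ?thesis by (simp add: fun_eq_iff)
qed

lemma real_moebius_compose:
  assumes "a' * d' - b' * c' = 1"
  shows "real_moebius a b c d \<circ> real_moebius a' b' c' d' =
    real_moebius (a * a' + b * c') (a * b' + b * d') (c * a' + d * c') (c * b' + d * d')"
proof -
  have "of_real a' * of_real d' - of_real b' * of_real c' \<noteq> (0::complex)"
    using assms by (metis of_real_diff of_real_mult of_real_1 zero_neq_one)
  then show ?thesis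
    by (simp add: fun_eq_iff real_moebius_def moebius_compose)
qed

lemma carrier_PSL2R_iff:
  "g \<in> carrier PSL2R \<longleftrightarrow> (\<exists>a b c d. g = real_moebius a b c d \<and> a * d - b * c = 1)"
  by (auto simp: PSL2R_def)

lemma carrier_PSL2RI: "a * d - b * c = 1 \<Longrightarrow> real_moebius a b c d \<in> carrier PSL2R"
  by (auto simp: carrier_PSL2R_iff)

lemma mult_PSL2R [simp]: "g \<otimes>\<^bsub>PSL2R\<^esub> h = g \<circ> h" and one_PSL2R [simp]: "\<one>\<^bsub>PSL2R\<^esub> = id"
  by (simp_all add: PSL2R_def)

lemma real_moebius_one: "real_moebius 1 0 0 1 = id"
  by (simp add: real_moebius_def moebius_scalar)

lemma group_PSL2R: "group PSL2R"
proof (rule groupI)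
  fix g h assume "g \<in> carrier PSL2R" "h \<in> carrier PSL2R"
  then obtain a b c d a' b' c' d' where
    gh: "g = real_moebius a b c d" "a * d - b * c = 1"
        "h = real_moebius a' b' c' d'" "a' * d' - b' * c' = 1"
    unfolding carrier_PSL2R_iff by blast
  have "(a * a' + b * c') * (c * b' + d * d') - (a * b' + b * d') * (c * a' + d * c') =
      (a * d - b * c) * (a' * d' - b' * c')"
    by (simp add: algebra_simps)
  then show "g \<otimes>\<^bsub>PSL2R\<^esub> h \<in> carrier PSL2R"
    using gh by (simp add: real_moebius_compose carrier_PSL2RI)
next
  show "\<one>\<^bsub>PSL2R\<^esub> \<in> carrier PSL2R"
    using carrier_PSL2RI[of 1 1 0 0] by (simp add: real_moebius_one)
next
  fix g assume "g \<in> carrier PSL2R"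
  then obtain a b c d where g: "g = real_moebius a b c d" "a * d - b * c = 1"
    unfolding carrier_PSL2R_iff by blast
  have "real_moebius d (-b) (-c) a \<circ> g = id"
    using g real_moebius_compose[OF g(2), of d "-b" "-c" a]
    by (simp add: real_moebius_one[symmetric] algebra_simps)
  moreover have "real_moebius d (-b) (-c) a \<in> carrier PSL2R"
    using g(2) by (intro carrier_PSL2RI) (simp add: algebra_simps)
  ultimately show "\<exists>h\<in>carrier PSL2R. h \<otimes>\<^bsub>PSL2R\<^esub> g = \<one>\<^bsub>PSL2R\<^esub>"
    by auto
qed (simp_all add: comp_assoc)

lemma inv_PSL2R:
  assumes "g \<in> carrier PSL2R"
  shows "inv\<^bsub>PSL2R\<^esub> g \<in> carrier PSL2R" "(inv\<^bsub>PSL2R\<^esub> g) (g x) = x" "g ((inv\<^bsub>PSL2R\<^esub> g) x) = x"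
proof -
  show "inv\<^bsub>PSL2R\<^esub> g \<in> carrier PSL2R"
    using group.inv_closed[OF group_PSL2R assms] .
  show "(inv\<^bsub>PSL2R\<^esub> g) (g x) = x" "g ((inv\<^bsub>PSL2R\<^esub> g) x) = x"
    using group.l_inv[OF group_PSL2R assms] group.r_inv[OF group_PSL2R assms]
    by (simp_all add: fun_eq_iff)
qed

lemma parabolic_PSL2R: "parabolic g \<Longrightarrow> g \<in> carrier PSL2R"
  by (auto simp: parabolic_def carrier_PSL2R_iff)

abbreviation half_plane_map :: "(sphere \<Rightarrow> sphere) \<Rightarrow> complex \<Rightarrow> complex" where
  "half_plane_map g x \<equiv> the (g (Some x))"

lemma PSL2R_half_plane:
  assumes "g \<in> carrier PSL2R" "x \<in> upper_half_plane"
  shows "half_plane_map g x \<in> upper_half_plane" "g (Some x) = Some (half_plane_map g x)"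
proof -
  obtain a b c d where "g = real_moebius a b c d" "a * d - b * c = 1"
    using assms(1) by (auto simp: carrier_PSL2R_iff)
  then obtain y where "Im y > 0" "g (Some x) = Some y"
    using real_moebius_half_plane assms(2) by (metis mem_Collect_eq upper_half_plane_def)
  then show "half_plane_map g x \<in> upper_half_plane" "g (Some x) = Some (half_plane_map g x)"
    by (auto simp: upper_half_plane_def)
qed

lemma half_plane_map_comp:
  "h \<in> carrier PSL2R \<Longrightarrow> x \<in> upper_half_plane \<Longrightarrow>
    half_plane_map (g \<circ> h) x = half_plane_map g (half_plane_map h x)"
  using PSL2R_half_plane(2)[of h x] by simp

lemma holomorphic_half_plane_map:
  assumes "g \<in> carrier PSL2R"
  shows "half_plane_map g holomorphic_on upper_half_plane"
proof -
  obtain a b c d where g: "g = real_moebius a b c d" "a * d - b * c = 1"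
    using assms by (auto simp: carrier_PSL2R_iff)
  have den: "of_real c * x + of_real d \<noteq> 0" if "x \<in> upper_half_plane" for x :: complex
  proof
    assume "of_real c * x + of_real d = 0"
    then have "g (Some x) = None"
      by (simp add: g real_moebius_def moebius_def)
    with PSL2R_half_plane(2)[OF assms that] show False by simp
  qed
  have "(\<lambda>x. (of_real a * x + of_real b) / (of_real c * x + of_real d)) holomorphic_on upper_half_plane"
    by (intro holomorphic_intros den)
  moreover have "half_plane_map g x = (of_real a * x + of_real b) / (of_real c * x + of_real d)"
    if "x \<in> upper_half_plane" for x
    using den[OF that] by (simp add: g real_moebius_def moebius_def)
  ultimately show ?thesis
    by (simp cong: holomorphic_cong)
qed

section \<open>Nonvanishing of the leading coefficients\<close>

text \<open>The values of \<open>f\<close> lie in the discrete set of multiples of \<open>2\<pi>\<i>\<close>.\<close>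

lemma exp_eq_one_constant:
  fixes f :: "'a::topological_space \<Rightarrow> complex"
  assumes "connected S" "continuous_on S f" "\<And>x. x \<in> S \<Longrightarrow> exp (f x) = 1"
  shows "f constant_on S"
proof (rule continuous_discrete_range_constant[OF assms(1,2)])
  fix x assume x: "x \<in> S"
  have "1 \<le> norm (f y - f x)" if "y \<in> S" "f y \<noteq> f x" for y
  proof -
    have "exp (f y) = exp (f x)" using assms(3) x that(1) by simp
    then obtain k :: int where k: "f y = f x + of_real (of_int (2 * k) * pi) * \<i>"
      unfolding exp_eq by blast
    then have "k \<noteq> 0" using that(2) by auto
    then have "1 \<le> \<bar>real_of_int k\<bar>" by linarith
    moreover have "norm (f y - f x) = 2 * pi * \<bar>real_of_int k\<bar>"
      by (simp add: k norm_mult)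
    moreover have "2 * pi * \<bar>real_of_int k\<bar> \<ge> 1 * \<bar>real_of_int k\<bar>"
      using pi_ge_two by (intro mult_right_mono) auto
    ultimately show ?thesis by linarith
  qed
  then show "\<exists>e>0. \<forall>y. y \<in> S \<and> f y \<noteq> f x \<longrightarrow> e \<le> norm (f y - f x)"
    by (intro exI[of _ 1]) auto
qed

text \<open>After division by \<open>q\<^sup>l\<close> an expansion in \<open>q\<close> is a power series. It converges at every point of the
  punctured disc, because each of them is a value of \<open>q\<close> on the half-plane; hence its sum is
  holomorphic on the whole disc.\<close>

lemma q_expansion_leading_term:
  assumes "\<And>x. x \<in> upper_half_plane \<Longrightarrow>
    ((\<lambda>k. c k * cusp_q x powi k) has_sum f x) {l..}"
  obtains u where "u holomorphic_on ball 0 1" "u 0 = c l"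
    "\<And>x. x \<in> upper_half_plane \<Longrightarrow> f x = cusp_q x powi l * u (cusp_q x)"
proof -
  define u where "u q = (\<Sum>k. c (l + int k) * q ^ k)" for q
  have sums: "(\<lambda>k. c (l + int k) * cusp_q x ^ k) sums (f x / cusp_q x powi l)"
    if x: "x \<in> upper_half_plane" for x
  proof -
    define q where "q = cusp_q x"
    have q: "q \<noteq> 0" by (simp add: q_def cusp_q_nonzero)
    have "bij_betw (\<lambda>k. l + int k) UNIV {l..}"
      by (rule bij_betwI[where g = "\<lambda>k. nat (k - l)"]) auto
    then have "((\<lambda>k. c (l + int k) * q powi (l + int k)) has_sum f x) UNIV"
      using assms[OF x] has_sum_reindex_bij_betw[of "\<lambda>k. l + int k" UNIV "{l..}" "\<lambda>k. c k * q powi k"]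
      by (simp add: q_def)
    then have "(\<lambda>k. c (l + int k) * q powi (l + int k) / q powi l) sums (f x / q powi l)"
      by (intro sums_divide has_sum_imp_sums)
    moreover have "c (l + int k) * q powi (l + int k) / q powi l = c (l + int k) * q ^ k" for k
      using q by (simp add: power_int_add)
    ultimately show ?thesis by (simp add: q_def)
  qed
  have conv: "(\<lambda>k. c (l + int k) * q ^ k) sums u q" if q: "cmod q < 1" for q
  proof (cases "q = 0")
    case True
    show ?thesis
      unfolding u_def True by (rule summable_sums[OF sums_summable[OF powser_sums_zero]])
  next
    case False
    then obtain x where x: "x \<in> upper_half_plane" "cusp_q x = q"
      using cusp_q_surj[OF False q] by blast
    show ?thesis
      unfolding u_def by (rule summable_sums) (use sums_summable[OF sums[OF x(1)]] x(2) in simp)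
  qed
  show ?thesis
  proof
    show "u holomorphic_on ball 0 1"
      by (rule power_series_holomorphic[where a = "\<lambda>k. c (l + int k)"]) (use conv in simp)
    show "u 0 = c l"
      unfolding u_def by (subst powser_zero) simp
    show "f x = cusp_q x powi l * u (cusp_q x)" if "x \<in> upper_half_plane" for x
      using sums_unique2[OF sums[OF that] conv[OF cusp_q_in_disc[OF that]]] cusp_q_nonzero[of x]
      by (simp add: field_simps)
  qed
qed

lemma moduli_value:
  assumes "w \<in> moduli n" "i \<in> {1..n-3}"
  shows "w i \<noteq> 0" "w i \<noteq> 1"
  using assms by (auto simp: moduli_def)

lemma puncture_finite: "i \<in> {1..n-1} \<Longrightarrow> puncture n w i = Some (the (puncture n w i))"
  by (auto simp: puncture_def)

lemma puncture_eq_iff: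
  assumes w: "w \<in> moduli n" and n: "n > 3" and ij: "i \<in> {1..n}" "j \<in> {1..n}"
  shows "puncture n w i = puncture n w j \<longleftrightarrow> i = j"
proof -
  have inj: "inj_on w {1..n-3}"
    using w by (simp add: moduli_def)
  have generic: "k \<in> {1..n-3} \<and> w k \<noteq> 0 \<and> w k \<noteq> 1"
    if "k \<in> {1..n}" "k \<noteq> n" "k \<noteq> n - 1" "k \<noteq> n - 2" for k
  proof -
    have "k \<in> {1..n-3}" using that by auto
    then show ?thesis using moduli_value[OF w] by blast
  qed
  have "i = j" if "puncture n w i = puncture n w j"
    using that generic[OF ij(1)] generic[OF ij(2)] inj_onD[OF inj, of i j]
    unfolding puncture_def by (auto split: if_splits)
  then show ?thesis by blast
qed

context uniformization
begin

lemma S_in_\<Gamma>: "i \<in> {1..n} \<Longrightarrow> S i \<in> \<Gamma>"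
  unfolding generated by (rule generate.incl) auto

lemma S_PSL2R: "i \<in> {1..n} \<Longrightarrow> S i \<in> carrier PSL2R"
  using parabolic_S parabolic_PSL2R by blast

lemma J_range: "x \<in> upper_half_plane \<Longrightarrow> J x \<notin> {0, 1} \<union> w ` {1..n-3}"
  using covering_space_imp_surjective[OF covering_J] by blast

lemma J_cusp_range:
  "i \<in> {1..n} \<Longrightarrow> x \<in> upper_half_plane \<Longrightarrow> J (half_plane_map (\<sigma> i) x) \<notin> {0, 1} \<union> w ` {1..n-3}"
  using J_range PSL2R_half_plane(1)[OF scaling(1)] by blast

lemma puncture_not_in_J_range:
  assumes "i \<in> {1..n-1}" "n > 3" "x \<in> upper_half_plane"
  shows "J x \<noteq> the (puncture n w i)"
  using assms J_range[OF assms(3)] by (auto simp: puncture_def)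

text \<open>In the coordinate \<open>\<sigma>\<^sub>i\<close> the generator \<open>S\<^sub>i\<close> is the translation by \<open>\<plusminus>1\<close>.\<close>

lemma S_scaling:
  assumes "i \<in> {1..n}"
  obtains e :: real where "e \<in> {1, -1}"
    "\<And>x. x \<in> upper_half_plane \<Longrightarrow>
       half_plane_map (S i) (half_plane_map (\<sigma> i) x) = half_plane_map (\<sigma> i) (x + of_real e)"
proof -
  obtain e :: real where e: "e \<in> {1, -1}"
    "inv\<^bsub>PSL2R\<^esub> (\<sigma> i) \<circ> S i \<circ> \<sigma> i = real_moebius 1 e 0 1"
    using scaling(3)[OF assms] by auto
  have "half_plane_map (S i) (half_plane_map (\<sigma> i) x) = half_plane_map (\<sigma> i) (x + of_real e)"
    if x: "x \<in> upper_half_plane" for x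
  proof -
    have "(inv\<^bsub>PSL2R\<^esub> (\<sigma> i)) (S i (\<sigma> i (Some x))) = Some (x + of_real e)"
      using fun_cong[OF e(2), of "Some x"] by (simp add: real_moebius_def moebius_def)
    then have "S i (\<sigma> i (Some x)) = \<sigma> i (Some (x + of_real e))"
      using inv_PSL2R(3)[OF scaling(1)[OF assms]] by metis
    then show ?thesis
      using PSL2R_half_plane(2)[OF scaling(1)[OF assms] x] by simp
  qed
  with e(1) that show ?thesis by blast
qed

text \<open>Since \<open>u\<close> has no zeros, it has a logarithm \<open>g\<close> on the disc, and \<open>L (\<sigma>\<^sub>i y)\<close> is
  \<open>2\<pi>\<i>my + g (q y)\<close> up to an additive constant. The term \<open>g (q y)\<close> has period 1, so the
  translation by \<open>\<plusminus>1\<close> that \<open>S\<^sub>i\<close> induces adds \<open>\<plusminus>2\<pi>\<i>m\<close>.\<close>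

lemma cusp_monodromy:
  assumes i: "i \<in> {1..n}"
    and contL: "continuous_on upper_half_plane L"
    and L: "\<And>x. x \<in> upper_half_plane \<Longrightarrow> exp (L x) = J x - c"
    and u: "u holomorphic_on ball 0 1" "\<And>q. q \<in> ball 0 1 \<Longrightarrow> u q \<noteq> 0"
    and J: "\<And>x. x \<in> upper_half_plane \<Longrightarrow>
      J (half_plane_map (\<sigma> i) x) - c = cusp_q x powi m * u (cusp_q x)"
  shows "\<exists>e\<in>{1, -1 :: real}. \<forall>x\<in>upper_half_plane.
    L (half_plane_map (S i) x) = L x + 2 * of_real pi * \<i> * of_real (m * e)"
proof -
  note \<sigma> = PSL2R_half_plane[OF scaling(1)[OF i]]
  obtain g where g: "g holomorphic_on ball 0 1" "\<And>q. q \<in> ball 0 1 \<Longrightarrow> u q = exp (g q)"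
    using contractible_imp_holomorphic_log[OF u(1) convex_imp_contractible[OF convex_ball] u(2)]
    by metis
  define \<Lambda> where "\<Lambda> y = L (half_plane_map (\<sigma> i) y) - 2 * of_real pi * \<i> * of_int m * y - g (cusp_q y)" for y
  have cont1: "continuous_on upper_half_plane (\<lambda>y. L (half_plane_map (\<sigma> i) y))"
    by (rule continuous_on_compose2[OF contL])
      (use \<sigma>(1) holomorphic_half_plane_map[OF scaling(1)[OF i]] in
        \<open>auto intro: holomorphic_on_imp_continuous_on\<close>)
  have cont2: "continuous_on upper_half_plane (\<lambda>y. g (cusp_q y))"
    by (rule continuous_on_compose2[OF holomorphic_on_imp_continuous_on[OF g(1)]])
      (use cusp_q_in_disc in \<open>auto simp: cusp_q_def intro!: continuous_intros\<close>)
  have "continuous_on upper_half_plane \<Lambda>"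
    unfolding \<Lambda>_def by (intro continuous_intros cont1 cont2)
  moreover have "exp (\<Lambda> y) = 1" if y: "y \<in> upper_half_plane" for y
  proof -
    have "exp (L (half_plane_map (\<sigma> i) y)) = cusp_q y powi m * exp (g (cusp_q y))"
      using L[OF \<sigma>(1)[OF y]] J[OF y] g(2) cusp_q_in_disc[OF y] by simp
    moreover have "cusp_q y powi m = exp (2 * of_real pi * \<i> * of_int m * y)"
      by (simp add: cusp_q_def exp_power_int mult_ac)
    ultimately show ?thesis
      by (simp add: \<Lambda>_def exp_diff)
  qed
  ultimately have "\<Lambda> constant_on upper_half_plane"
    by (intro exp_eq_one_constant convex_connected convex_upper_half_plane)
  then obtain C where C: "\<And>y. y \<in> upper_half_plane \<Longrightarrow> \<Lambda> y = C"
    unfolding constant_on_def by blast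
  obtain e :: real where e: "e \<in> {1, -1}"
    "\<And>x. x \<in> upper_half_plane \<Longrightarrow>
       half_plane_map (S i) (half_plane_map (\<sigma> i) x) = half_plane_map (\<sigma> i) (x + of_real e)"
    using S_scaling[OF i] by blast
  have periodic: "cusp_q (y + of_real e) = cusp_q y" for y
  proof -
    have "exp (2 * of_real pi * \<i>) = (1::complex)" by simp
    then show ?thesis
      using e(1) by (auto simp: cusp_q_def distrib_left exp_add exp_diff exp_minus right_diff_distrib)
  qed
  have "L (half_plane_map (S i) x) = L x + 2 * of_real pi * \<i> * of_real (m * e)"
    if x: "x \<in> upper_half_plane" for x
  proof -
    define y where "y = half_plane_map (inv\<^bsub>PSL2R\<^esub> (\<sigma> i)) x"
    note \<sigma>' = inv_PSL2R[OF scaling(1)[OF i]]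
    have y: "y \<in> upper_half_plane" and xy: "x = half_plane_map (\<sigma> i) y"
      using PSL2R_half_plane[OF \<sigma>'(1) x] \<sigma>'(3)[of "Some x"] by (simp_all add: y_def)
    have "y + of_real e \<in> upper_half_plane"
      using y by (simp add: upper_half_plane_def)
    then have "\<Lambda> (y + of_real e) = \<Lambda> y"
      using C y by simp
    then show ?thesis
      using e(2)[OF y] by (simp add: \<Lambda>_def xy periodic algebra_simps)
  qed
  then show ?thesis
    using e(1) by (intro bexI[of _ e] ballI)
qed

text \<open>This is continuity of the extension of \<open>J\<close> at the cusp \<open>z\<^sub>n\<close>, with the complement of a closed disc
  as neighbourhood of infinity: its preimage contains a horodisc.\<close>

lemma J_tends_to_infinity_at_last_cusp:
  assumes "n > 3"
  obtains Y where "\<And>x. Im x > Y \<Longrightarrow> x \<in> upper_half_plane \<and> cmod (J (half_plane_map (\<sigma> n) x)) > R"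
proof -
  have n: "n \<in> {1..n}" using assms by simp
  obtain Jx where Jx: "\<And>x. x \<in> upper_half_plane \<Longrightarrow> Jx (Some x) = Some (J x)"
    and quot: "quotient_map (horocycle_topology \<Gamma>) sphere_topology Jx"
    and Jz: "\<And>i. i \<in> {1..n} \<Longrightarrow> Jx (z i) = puncture n w i"
    using extends_J by blast
  define V where "V = insert None (Some ` (UNIV - cball (0::complex) R))"
  have V: "openin sphere_topology V"
    unfolding sphere_topology_def openin_Alexandroff_compactification V_def
    by (intro disjI2 exI[of _ "cball 0 R"]) simp
  define U where "U = {x \<in> extended_half_plane \<Gamma>. Jx x \<in> V}"
  have "openin (horocycle_topology \<Gamma>) U"
    using continuous_map_openin_preimage_eq[of "horocycle_topology \<Gamma>" sphere_topology Jx]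
      quotient_imp_continuous_map[OF quot] V
    by (auto simp: openin_continuous_map_preimage U_def topspace_horocycle_topology
        dest!: openin_continuous_map_preimage)
  then have U: "horocycle_open \<Gamma> U"
    by (simp add: openin_horocycle_topology)
  have "z n \<in> cusps \<Gamma>"
    using S_in_\<Gamma>[OF n] parabolic_S[OF n] fixed_point[OF n] by (auto simp: cusps_def)
  moreover have "z n \<in> U"
    using calculation Jz[OF n] by (simp add: U_def extended_half_plane_def V_def puncture_def)
  ultimately have "\<sigma> n None \<in> U \<inter> cusps \<Gamma>"
    using scaling(2)[OF n] by simp
  then obtain Y where Y: "Y > 0" "\<And>x. Im x > Y \<Longrightarrow> \<sigma> n (Some x) \<in> U"
    using U scaling(1)[OF n] unfolding horocycle_open_def by blast
  have "x \<in> upper_half_plane \<and> cmod (J (half_plane_map (\<sigma> n) x)) > R" if "Im x > Y" for x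
  proof -
    have x: "x \<in> upper_half_plane" using that Y(1) by (simp add: upper_half_plane_def)
    note \<sigma> = PSL2R_half_plane[OF scaling(1)[OF n] x]
    have "Some (J (half_plane_map (\<sigma> n) x)) \<in> V"
      using Y(2)[OF that] Jx[OF \<sigma>(1)] \<sigma>(2) by (simp add: U_def)
    then show ?thesis using x by (auto simp: V_def)
  qed
  with that show ?thesis by blast
qed

text \<open>Without the term \<open>q\<inverse>\<close> the expansion would be bounded near the last cusp.\<close>

lemma last_cusp_coefficient_nonzero:
  assumes "n > 3"
  shows "a n (-1) \<noteq> 0"
proof
  assume zero: "a n (-1) = 0"
  have a0: "a n k = 0" if "k \<in> {-1..} - {0..}" for k
  proof -
    have "k = -1" using that by auto
    then show ?thesis using zero by simp
  qed
  have "((\<lambda>k. a n k * cusp_q x powi k) has_sum J (half_plane_map (\<sigma> n) x)) {0..}"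
    if "x \<in> upper_half_plane" for x
    by (rule has_sum_cong_neutral[THEN iffD1, OF _ _ _ expansion_infinity[OF that]])
      (use a0 in auto)
  then obtain u where u: "u holomorphic_on ball 0 1"
    "\<And>x. x \<in> upper_half_plane \<Longrightarrow> J (half_plane_map (\<sigma> n) x) = cusp_q x powi 0 * u (cusp_q x)"
    using q_expansion_leading_term[where c = "a n" and f = "\<lambda>x. J (half_plane_map (\<sigma> n) x)" and l = 0] by blast
  have "isCont u 0"
    by (intro field_differentiable_imp_continuous_at holomorphic_on_imp_differentiable_at[OF u(1)]) auto
  then have "((\<lambda>q. cmod (u q)) \<longlongrightarrow> cmod (u 0)) (nhds 0)"
    by (simp add: tendsto_norm isCont_def tendsto_at_iff_tendsto_nhds)
  then have "eventually (\<lambda>q. cmod (u q) < cmod (u 0) + 1) (nhds 0)"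
    by (rule order_tendstoD) simp
  then obtain \<delta> where \<delta>: "\<delta> > 0" "\<And>q. cmod q < \<delta> \<Longrightarrow> cmod (u q) < cmod (u 0) + 1"
    unfolding eventually_nhds_metric by auto
  obtain Y where Y: "\<And>x. Im x > Y \<Longrightarrow>
      x \<in> upper_half_plane \<and> cmod (J (half_plane_map (\<sigma> n) x)) > cmod (u 0) + 1"
    using J_tends_to_infinity_at_last_cusp[OF assms] by blast
  \<comment> \<open>High enough for \<open>|q| < \<delta>\<close> at the point \<open>\<i>t\<close>.\<close>
  define t where "t = max Y (- ln \<delta> / (2 * pi)) + 1"
  have "exp (- 2 * pi * t) < exp (ln \<delta>)"
  proof -
    have "- ln \<delta> / (2 * pi) < t" by (simp add: t_def)
    then have "- ln \<delta> < t * (2 * pi)" by (simp add: field_simps)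
    then show ?thesis by (simp add: mult_ac)
  qed
  then have "cmod (cusp_q (\<i> * of_real t)) < \<delta>"
    using \<delta>(1) by (simp add: norm_cusp_q)
  moreover have "Y < Im (\<i> * of_real t)"
    by (simp add: t_def)
  ultimately show False
    using Y[of "\<i> * of_real t"] u(2)[of "\<i> * of_real t"] \<delta>(2) by fastforce
qed

text \<open>A function that each generator \<open>S\<^sub>j\<close> changes by a constant is changed by the product
  \<open>S\<^sub>1 \<cdots> S\<^sub>n = 1\<close> by the sum of these constants.\<close>

lemma product_monodromy:
  fixes d :: "nat \<Rightarrow> complex"
  assumes d: "\<And>j x. j \<in> {1..n} \<Longrightarrow> x \<in> upper_half_plane \<Longrightarrow> L (half_plane_map (S j) x) = L x + d j"
  shows "(\<Sum>j\<in>{1..n}. d j) = 0"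
proof -
  define P where "P xs = foldr (\<lambda>i g. S i \<otimes>\<^bsub>PSL2R\<^esub> g) xs \<one>\<^bsub>PSL2R\<^esub>" for xs
  have P: "P xs \<in> carrier PSL2R \<and>
      (\<forall>x\<in>upper_half_plane. L (half_plane_map (P xs) x) = L x + (\<Sum>j\<leftarrow>xs. d j))"
    if "set xs \<subseteq> {1..n}" for xs
    using that
  proof (induction xs)
    case Nil
    then show ?case
      using group.is_monoid[OF group_PSL2R, THEN monoid.one_closed] by (simp add: P_def id_def)
  next
    case (Cons i xs)
    then have IH: "P xs \<in> carrier PSL2R"
      "\<And>x. x \<in> upper_half_plane \<Longrightarrow> L (half_plane_map (P xs) x) = L x + (\<Sum>j\<leftarrow>xs. d j)"
      and i: "i \<in> {1..n}" by auto
    have PC: "P (i # xs) = S i \<circ> P xs" by (simp add: P_def)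
    have "S i \<otimes>\<^bsub>PSL2R\<^esub> P xs \<in> carrier PSL2R"
      using group.is_monoid[OF group_PSL2R] S_PSL2R[OF i] IH(1) by (rule monoid.m_closed)
    then have "P (i # xs) \<in> carrier PSL2R"
      by (simp only: PC mult_PSL2R)
    moreover have "L (half_plane_map (P (i # xs)) x) = L x + (\<Sum>j\<leftarrow>i # xs. d j)"
      if x: "x \<in> upper_half_plane" for x
      unfolding PC half_plane_map_comp[OF IH(1) x]
      using d[OF i PSL2R_half_plane(1)[OF IH(1) x]] IH(2)[OF x] by simp
    ultimately show ?case by blast
  qed
  have "P [1..<Suc n] = id"
    using product_S by (simp only: P_def one_PSL2R)
  moreover have "\<i> \<in> upper_half_plane"
    by (simp add: upper_half_plane_def)
  moreover have "set [1..<Suc n] \<subseteq> {1..n}"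
    by (simp only: set_upt atLeastLessThanSuc_atLeastAtMost)
  ultimately have "(\<Sum>j\<leftarrow>[1..<Suc n]. d j) = 0"
    using P[of "[1..<Suc n]"] by (auto simp del: upt_Suc)
  then show ?thesis
    by (simp only: interv_sum_list_conv_sum_set_nat set_upt atLeastLessThanSuc_atLeastAtMost)
qed

text \<open>Let \<open>m\<close> be the order of \<open>J - w\<^sub>i\<close> at the cusp \<open>i\<close>. A logarithm of \<open>J - w\<^sub>i\<close> changes by
  \<open>\<plusminus>2\<pi>\<i>m\<close> under \<open>S\<^sub>i\<close>, by \<open>\<plusminus>2\<pi>\<i>\<close> under \<open>S\<^sub>n\<close>, where \<open>J\<close> has a simple pole, and is fixed
  by the other generators, because \<open>J - w\<^sub>i\<close> has a finite nonzero limit at their cusps. These changes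
  add up to 0, so \<open>m = 1\<close>.\<close>

lemma finite_cusp_coefficient_nonzero:
  assumes n: "n > 3" and w: "w \<in> moduli n" and i: "i \<in> {1..n-1}"
  shows "a i 1 \<noteq> 0"
proof -
  define c where "c = the (puncture n w i)"
  have "contractible upper_half_plane"
    by (rule convex_imp_contractible[OF convex_upper_half_plane])
  moreover have "(\<lambda>x. J x - c) holomorphic_on upper_half_plane"
    by (intro holomorphic_intros holomorphic_J)
  moreover have Jc: "J x - c \<noteq> 0" if "x \<in> upper_half_plane" for x
    using puncture_not_in_J_range[OF i n that] by (simp add: c_def)
  ultimately obtain L where L: "L holomorphic_on upper_half_plane"
    "\<And>x. x \<in> upper_half_plane \<Longrightarrow> exp (L x) = J x - c"
    using contractible_imp_holomorphic_log[of "\<lambda>x. J x - c" upper_half_plane] by metis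
  note contL = holomorphic_on_imp_continuous_on[OF L(1)]
  have J\<sigma>c: "J (half_plane_map (\<sigma> j) x) - c \<noteq> 0" if "x \<in> upper_half_plane" "j \<in> {1..n}" for j x
    using Jc PSL2R_half_plane(1)[OF scaling(1)[OF that(2)] that(1)] by blast
  \<comment> \<open>\<open>J - c\<close> has order \<open>m\<close> at the \<open>j\<close>-th cusp.\<close>
  define good where "good j m u \<longleftrightarrow> u holomorphic_on ball 0 1 \<and> u 0 \<noteq> 0 \<and>
      (\<forall>x\<in>upper_half_plane. J (half_plane_map (\<sigma> j) x) - c = cusp_q x powi m * u (cusp_q x))"
    for j :: nat and m :: int and u :: "complex \<Rightarrow> complex"
  have monodromy: "\<exists>e\<in>{1, -1 :: real}. \<forall>x\<in>upper_half_plane.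
      L (half_plane_map (S j) x) = L x + 2 * of_real pi * \<i> * of_real (m * e)"
    if j: "j \<in> {1..n}" and g: "good j m u" for j m u
  proof -
    have u0: "u q \<noteq> 0" if q: "q \<in> ball 0 1" for q
    proof (cases "q = 0")
      case False
      obtain x where "x \<in> upper_half_plane" "cusp_q x = q"
        using cusp_q_surj[OF False] q by auto
      then show ?thesis
        using g J\<sigma>c[of x j] j by (auto simp: good_def)
    qed (use g in \<open>simp add: good_def\<close>)
    have uh: "u holomorphic_on ball 0 1"
      and uJ: "\<And>x. x \<in> upper_half_plane \<Longrightarrow>
        J (half_plane_map (\<sigma> j) x) - c = cusp_q x powi m * u (cusp_q x)"
      using g by (simp_all add: good_def)
    show ?thesis
      by (rule cusp_monodromy[OF j contL]) (use L(2) uh u0 uJ in auto)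
  qed
  have "\<exists>m\<ge>1. a i m \<noteq> 0"
  proof (rule ccontr)
    assume "\<not> ?thesis"
    then have "((\<lambda>k. a i k * cusp_q \<i> powi k) has_sum 0) {1..}"
      by (intro has_sum_0) auto
    moreover have \<i>: "\<i> \<in> upper_half_plane" by (simp add: upper_half_plane_def)
    ultimately have "J (half_plane_map (\<sigma> i) \<i>) - c = 0"
      using has_sum_unique expansion[OF i \<i>] unfolding c_def by blast
    moreover have "i \<in> {1..n}" using i by auto
    ultimately show False using J\<sigma>c[OF \<i>] by blast
  qed
  then have ex: "\<exists>k. a i (1 + int k) \<noteq> 0"
    by (metis add.commute diff_add_cancel le_add_diff_inverse nonneg_int_cases zle_iff_zadd)
  \<comment> \<open>The order of \<open>J - c\<close> at the \<open>i\<close>-th cusp is \<open>m\<close>; it exists because \<open>J\<close> omits the value \<open>c\<close>.\<close>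
  define k where "k = (LEAST k. a i (1 + int k) \<noteq> 0)"
  define m where "m = 1 + int k"
  have m: "m \<ge> 1" "a i m \<noteq> 0"
    using LeastI_ex[OF ex] by (simp_all add: m_def k_def)
  have below: "a i l = 0" if "l \<in> {1..} - {m..}" for l
  proof -
    have "nat (l - 1) < k" using that by (auto simp: m_def)
    then have "a i (1 + int (nat (l - 1))) = 0"
      using not_less_Least[of "nat (l - 1)" "\<lambda>k. a i (1 + int k) \<noteq> 0"] by (simp add: k_def)
    then show ?thesis using that by simp
  qed
  have "\<exists>u. good i m u"
  proof -
    have "((\<lambda>k. a i k * cusp_q x powi k) has_sum (J (half_plane_map (\<sigma> i) x) - c)) {m..}"
      if "x \<in> upper_half_plane" for x
      unfolding c_def
      by (rule has_sum_cong_neutral[THEN iffD1, OF _ _ _ expansion[OF i that]]) (use m below in auto)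
    from q_expansion_leading_term[OF this] show ?thesis
      unfolding good_def using m(2) by metis
  qed
  moreover have "\<exists>u. good j 0 u" if j: "j \<in> {1..n-1}" "j \<noteq> i" for j
  proof -
    obtain u where u: "u holomorphic_on ball 0 1"
      "\<And>x. x \<in> upper_half_plane \<Longrightarrow>
         J (half_plane_map (\<sigma> j) x) - the (puncture n w j) = cusp_q x powi 1 * u (cusp_q x)"
      using q_expansion_leading_term[where c = "a j"
          and f = "\<lambda>x. J (half_plane_map (\<sigma> j) x) - the (puncture n w j)" and l = 1]
        expansion[OF j(1)] by blast
    define v where "v = the (puncture n w j)"
    have "v \<noteq> c"
    proof
      assume "v = c"
      then have "puncture n w j = puncture n w i"
        using puncture_finite[OF j(1), of w] puncture_finite[OF i, of w] by (simp add: v_def c_def)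
      moreover have "i \<in> {1..n}" "j \<in> {1..n}" using i j by auto
      ultimately show False
        using puncture_eq_iff[OF w n] j(2) by blast
    qed
    moreover have "(\<lambda>q. v - c + q * u q) holomorphic_on ball 0 1"
      by (intro holomorphic_intros u(1))
    moreover have "J (half_plane_map (\<sigma> j) x) - c =
        cusp_q x powi 0 * (v - c + cusp_q x * u (cusp_q x))"
      if "x \<in> upper_half_plane" for x
      using u(2)[OF that] by (simp add: v_def algebra_simps)
    ultimately have "good j 0 (\<lambda>q. v - c + q * u q)"
      unfolding good_def by simp
    then show ?thesis by blast
  qed
  moreover have "\<exists>u. good n (-1) u"
  proof -
    obtain u where u: "u holomorphic_on ball 0 1" "u 0 = a n (-1)"
      "\<And>x. x \<in> upper_half_plane \<Longrightarrow> J (half_plane_map (\<sigma> n) x) = cusp_q x powi (-1) * u (cusp_q x)"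
      using q_expansion_leading_term[where c = "a n" and f = "\<lambda>x. J (half_plane_map (\<sigma> n) x)" and l = "-1"]
        expansion_infinity by blast
    have "(\<lambda>q. u q - c * q) holomorphic_on ball 0 1"
      by (intro holomorphic_intros u(1))
    moreover have "u 0 - c * 0 \<noteq> 0"
      using u(2) last_cusp_coefficient_nonzero[OF n] by simp
    moreover have "J (half_plane_map (\<sigma> n) x) - c = cusp_q x powi (-1) * (u (cusp_q x) - c * cusp_q x)"
      if "x \<in> upper_half_plane" for x
      using cusp_q_nonzero[of x] unfolding u(3)[OF that]
      by (simp add: power_int_minus right_diff_distrib)
    ultimately have "good n (-1) (\<lambda>q. u q - c * q)"
      unfolding good_def by blast
    then show ?thesis by blast
  qed
  moreover define M where "M j = (if j = i then m else if j = n then -1 else 0)" for j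
  ultimately have "\<exists>u. good j (M j) u" if "j \<in> {1..n}" for j
    using that i n by (cases "j = n"; cases "j = i") auto
  then have "\<forall>j\<in>{1..n}. \<exists>e\<in>{1, -1 :: real}. \<forall>x\<in>upper_half_plane.
      L (half_plane_map (S j) x) = L x + 2 * of_real pi * \<i> * of_real (M j * e)"
    using monodromy by blast
  then obtain e :: "nat \<Rightarrow> real" where e: "\<And>j. j \<in> {1..n} \<Longrightarrow> e j \<in> {1, -1}"
    "\<And>j x. j \<in> {1..n} \<Longrightarrow> x \<in> upper_half_plane \<Longrightarrow>
      L (half_plane_map (S j) x) = L x + 2 * of_real pi * \<i> * of_real (M j * e j)"
    by metis
  have "(\<Sum>j\<in>{1..n}. 2 * of_real pi * \<i> * complex_of_real (M j * e j)) = 0"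
    by (rule product_monodromy[OF e(2)])
  then have "complex_of_real (\<Sum>j\<in>{1..n}. M j * e j) = 0"
    by (simp add: sum_distrib_left[symmetric])
  then have "(\<Sum>j\<in>{1..n}. M j * e j) = 0"
    by (simp only: of_real_eq_0_iff)
  moreover have "(\<Sum>j\<in>{1..n}. M j * e j) = (\<Sum>j\<in>{i, n}. M j * e j)"
    using i by (intro sum.mono_neutral_right) (auto simp: M_def)
  moreover have "i \<noteq> n"
    using i n by auto
  then have "(\<Sum>j\<in>{i, n}. M j * e j) = m * e i - e n"
    by (simp add: M_def)
  ultimately have "m * e i = e n"
    by simp
  then have "m = 1"
  proof -
    have "i \<in> {1..n}" "n \<in> {1..n}" using i by auto
    then have "e i \<in> {1, -1}" "e n \<in> {1, -1}" using e(1) by auto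
    with \<open>m * e i = e n\<close> m(1) show ?thesis by auto
  qed
  with m(2) show ?thesis by simp
qed

end

section \<open>The leading coefficients under biholomorphic maps\<close>

text \<open>A coordinate of the sphere that vanishes at the \<open>i\<close>-th puncture.\<close>

definition puncture_chart :: "nat \<Rightarrow> (nat \<Rightarrow> complex) \<Rightarrow> nat \<Rightarrow> complex \<Rightarrow> complex" where
  "puncture_chart n w i \<zeta> = (if i = n then 1 / \<zeta> else \<zeta> - the (puncture n w i))"

text \<open>The derivative at \<open>q = 0\<close> of \<open>J \<circ> \<sigma>\<^sub>i\<close> in the coordinate \<open>puncture_chart n w i\<close>. The coordinate
  at infinity is a reciprocal, which accounts for the exponent of \<open>h\<^sub>n\<close> in the metric.\<close>

definition leading_coeff :: "nat \<Rightarrow> (nat \<Rightarrow> int \<Rightarrow> complex) \<Rightarrow> nat \<Rightarrow> complex" where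
  "leading_coeff n a i = (if i = n then 1 / a n (-1) else a i 1)"

abbreviation punctured_plane :: "nat \<Rightarrow> (nat \<Rightarrow> complex) \<Rightarrow> complex set" where
  "punctured_plane n w \<equiv> UNIV - ({0, 1} \<union> w ` {1..n-3})"

lemma puncture_chart_inj:
  assumes "\<zeta> \<in> punctured_plane n w" "\<zeta>' \<in> punctured_plane n w"
    "puncture_chart n w i \<zeta> = puncture_chart n w i \<zeta>'"
  shows "\<zeta> = \<zeta>'"
  using assms by (auto simp: puncture_chart_def split: if_splits)

context uniformization
begin

lemma leading_coeff_nonzero:
  assumes "n > 3" "w \<in> moduli n" "i \<in> {1..n}"
  shows "leading_coeff n a i \<noteq> 0"
proof (cases "i = n")
  case False
  then have "i \<in> {1..n-1}" using assms(3) by auto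
  then show ?thesis
    using finite_cusp_coefficient_nonzero[OF assms(1,2)] False by (simp add: leading_coeff_def)
qed (simp add: leading_coeff_def last_cusp_coefficient_nonzero[OF assms(1)])

lemma cusp_local_parameter:
  assumes n: "n > 3" and i: "i \<in> {1..n}"
  obtains \<Phi> where "\<Phi> holomorphic_on ball 0 1" "\<Phi> 0 = 0"
    "(\<Phi> has_field_derivative leading_coeff n a i) (at 0)"
    "\<And>x. x \<in> upper_half_plane \<Longrightarrow>
       puncture_chart n w i (J (half_plane_map (\<sigma> i) x)) = \<Phi> (cusp_q x)"
proof (cases "i = n")
  case True
  obtain u where u: "u holomorphic_on ball 0 1" "u 0 = a n (-1)"
    "\<And>x. x \<in> upper_half_plane \<Longrightarrow> J (half_plane_map (\<sigma> n) x) = cusp_q x powi (-1) * u (cusp_q x)"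
    using q_expansion_leading_term[where c = "a n" and f = "\<lambda>x. J (half_plane_map (\<sigma> n) x)" and l = "-1"]
      expansion_infinity by blast
  have u0: "u q \<noteq> 0" if q: "q \<in> ball 0 1" for q
  proof (cases "q = 0")
    case False
    obtain x where x: "x \<in> upper_half_plane" "cusp_q x = q"
      using cusp_q_surj[OF False] q by auto
    then show ?thesis
      using u(3)[OF x(1)] J_cusp_range[OF i x(1)] \<open>i = n\<close> by auto
  qed (simp add: u(2) last_cusp_coefficient_nonzero[OF n])
  have "((\<lambda>q. q / u q) has_field_derivative leading_coeff n a i) (at 0)"
  proof -
    have "(u has_field_derivative deriv u 0) (at 0)"
      by (rule holomorphic_derivI[OF u(1)]) auto
    from DERIV_divide[OF DERIV_ident this u0[of 0]] show ?thesis
      using u0[of 0] by (simp add: leading_coeff_def True u(2)[symmetric])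
  qed
  moreover have "(\<lambda>q. q / u q) holomorphic_on ball 0 1"
    by (intro holomorphic_intros u(1) u0)
  moreover have "puncture_chart n w i (J (half_plane_map (\<sigma> i) x)) = cusp_q x / u (cusp_q x)"
    if "x \<in> upper_half_plane" for x
    using u(3)[OF that] by (simp add: True puncture_chart_def power_int_minus divide_inverse)
  ultimately show ?thesis
    by (intro that[of "\<lambda>q. q / u q"]) auto
next
  case False
  then have i': "i \<in> {1..n-1}" using i by auto
  obtain u where u: "u holomorphic_on ball 0 1" "u 0 = a i 1"
    "\<And>x. x \<in> upper_half_plane \<Longrightarrow>
       J (half_plane_map (\<sigma> i) x) - the (puncture n w i) = cusp_q x powi 1 * u (cusp_q x)"
    using q_expansion_leading_term[where c = "a i"
          and f = "\<lambda>x. J (half_plane_map (\<sigma> i) x) - the (puncture n w i)" and l = 1]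
      expansion[OF i'] by blast
  have "((\<lambda>q. q * u q) has_field_derivative leading_coeff n a i) (at 0)"
  proof -
    have "(u has_field_derivative deriv u 0) (at 0)"
      by (rule holomorphic_derivI[OF u(1)]) auto
    from DERIV_mult[OF DERIV_ident this] show ?thesis
      by (simp add: leading_coeff_def False u(2)[symmetric])
  qed
  moreover have "(\<lambda>q. q * u q) holomorphic_on ball 0 1"
    by (intro holomorphic_intros u(1))
  ultimately show ?thesis
    using u(3) by (intro that[of "\<lambda>q. q * u q"]) (simp_all add: False puncture_chart_def)
qed

text \<open>The lift exists because the half-plane is simply connected, and it is holomorphic because \<open>J\<close> is
  locally biholomorphic.\<close>

lemma lift_through_cusp_map:
  assumes i: "i \<in> {1..n}" and K: "K holomorphic_on upper_half_plane"
    "K \<in> upper_half_plane \<rightarrow> punctured_plane n w"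
    and xy: "x \<in> upper_half_plane" "y \<in> upper_half_plane" "J (half_plane_map (\<sigma> i) x) = K y"
  shows "\<exists>F. F holomorphic_on upper_half_plane \<and> F \<in> upper_half_plane \<rightarrow> upper_half_plane \<and>
    F y = x \<and> (\<forall>v\<in>upper_half_plane. J (half_plane_map (\<sigma> i) (F v)) = K v)"
proof -
  note \<sigma> = PSL2R_half_plane[OF scaling(1)[OF i]]
  define \<tau> where "\<tau> = inv\<^bsub>PSL2R\<^esub> (\<sigma> i)"
  note \<tau> = inv_PSL2R[OF scaling(1)[OF i], folded \<tau>_def]
  note \<tau>H = PSL2R_half_plane[OF \<tau>(1)]
  have "simply_connected upper_half_plane" "locally path_connected upper_half_plane"
    by (simp_all add: convex_imp_simply_connected convex_upper_half_plane
        open_imp_locally_path_connected open_upper_half_plane)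
  then obtain G where G: "continuous_on upper_half_plane G" "G \<in> upper_half_plane \<rightarrow> upper_half_plane"
    "G y = half_plane_map (\<sigma> i) x" "\<And>v. v \<in> upper_half_plane \<Longrightarrow> J (G v) = K v"
    using covering_space_lift_strong[OF covering_J \<sigma>(1)[OF xy(1)] xy(2) _ _
        holomorphic_on_imp_continuous_on[OF K(1)] K(2) xy(3)[symmetric]] by blast
  have holG: "G holomorphic_on upper_half_plane"
    by (rule covering_space_lift_is_holomorphic[OF covering_J open_upper_half_plane holomorphic_J
        K G(2,1,4)])
  define F where "F v = half_plane_map \<tau> (G v)" for v
  have "F holomorphic_on upper_half_plane"
    unfolding F_def
    using holomorphic_on_compose_gen[OF holG holomorphic_half_plane_map[OF \<tau>(1)]] G(2)
    by (simp add: o_def image_subset_iff_funcset)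
  moreover have "F \<in> upper_half_plane \<rightarrow> upper_half_plane"
    using G(2) \<tau>H(1) unfolding F_def by blast
  moreover have "F y = x"
    using \<sigma>(2)[OF xy(1)] \<tau>(2)[of "Some x"] by (simp add: F_def G(3))
  moreover have "J (half_plane_map (\<sigma> i) (F v)) = K v" if "v \<in> upper_half_plane" for v
  proof -
    have "G v \<in> upper_half_plane" using G(2) that by blast
    then have "\<sigma> i (Some (F v)) = Some (G v)"
      using \<tau>H(2)[of "G v"] \<tau>(3)[of "Some (G v)"] by (simp add: F_def)
    then show ?thesis using G(4)[OF that] by simp
  qed
  ultimately show ?thesis by blast
qed

end

text \<open>In the coordinates at the two punctures a Moebius map that takes one puncture to the other has the
  form \<open>A\<zeta> / (C\<zeta> + D)\<close>, with derivative \<open>A / D\<close> at 0. Thus the left-hand side is the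
  leading coefficient of \<open>m \<circ> J \<circ> \<sigma>\<^sub>i\<close>, which is compared with that of the covering map
  \<open>J' \<circ> \<sigma>'\<^sub>j\<close> of the target.\<close>

lemma leading_coeff_le:
  assumes uw: "uniformization n w \<Gamma> S z J \<sigma> a" and uv: "uniformization n v \<Gamma>' S' z' J' \<sigma>' a'"
    and n: "n > 3" and v: "v \<in> moduli n" and ij: "i \<in> {1..n}" "j \<in> {1..n}"
    and m: "m holomorphic_on punctured_plane n w" "m \<in> punctured_plane n w \<rightarrow> punctured_plane n v"
    and chart: "\<And>\<zeta>. \<zeta> \<in> punctured_plane n w \<Longrightarrow>
      puncture_chart n v j (m \<zeta>) =
        A * puncture_chart n w i \<zeta> / (C * puncture_chart n w i \<zeta> + D)" and D: "D \<noteq> 0"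
  shows "cmod (A / D * leading_coeff n a i) \<le> cmod (leading_coeff n a' j)"
proof -
  interpret w: uniformization n w \<Gamma> S z J \<sigma> a by (rule uw)
  interpret v: uniformization n v \<Gamma>' S' z' J' \<sigma>' a' by (rule uv)
  obtain \<Phi> where \<Phi>: "\<Phi> holomorphic_on ball 0 1" "\<Phi> 0 = 0"
    "(\<Phi> has_field_derivative leading_coeff n a i) (at 0)"
    "\<And>x. x \<in> upper_half_plane \<Longrightarrow>
       puncture_chart n w i (J (half_plane_map (\<sigma> i) x)) = \<Phi> (cusp_q x)"
    using w.cusp_local_parameter[OF n ij(1)] by blast
  obtain \<Psi> where \<Psi>: "\<Psi> holomorphic_on ball 0 1" "\<Psi> 0 = 0"
    "(\<Psi> has_field_derivative leading_coeff n a' j) (at 0)"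
    "\<And>x. x \<in> upper_half_plane \<Longrightarrow>
       puncture_chart n v j (J' (half_plane_map (\<sigma>' j) x)) = \<Psi> (cusp_q x)"
    using v.cusp_local_parameter[OF n ij(2)] by blast
  define K where "K x = m (J (half_plane_map (\<sigma> i) x))" for x
  have J\<sigma>: "(\<lambda>x. J (half_plane_map (\<sigma> i) x)) holomorphic_on upper_half_plane"
    using holomorphic_on_compose_gen[OF holomorphic_half_plane_map[OF w.scaling(1)[OF ij(1)]] w.holomorphic_J]
      PSL2R_half_plane(1)[OF w.scaling(1)[OF ij(1)]]
    by (simp add: o_def image_subset_iff)
  have J\<sigma>X: "J (half_plane_map (\<sigma> i) x) \<in> punctured_plane n w" if "x \<in> upper_half_plane" for x
    using w.J_cusp_range[OF ij(1) that] by simp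
  have K: "K holomorphic_on upper_half_plane" "K \<in> upper_half_plane \<rightarrow> punctured_plane n v"
  proof -
    show "K holomorphic_on upper_half_plane"
      unfolding K_def
      by (rule holomorphic_on_compose_gen[OF J\<sigma> m(1), unfolded o_def]) (intro image_subsetI J\<sigma>X)
    show "K \<in> upper_half_plane \<rightarrow> punctured_plane n v"
      unfolding K_def using m(2) J\<sigma>X by blast
  qed
  show ?thesis
  proof (rule cusp_coefficient_le[where ?K1.0 = "\<lambda>x. J' (half_plane_map (\<sigma>' j) x)" and ?K2.0 = K
        and \<tau> = "puncture_chart n v j" and U = "ball 0 1"])
    show "\<exists>F. F holomorphic_on upper_half_plane \<and> F \<in> upper_half_plane \<rightarrow> upper_half_plane \<and>
        F y = x \<and> (\<forall>z\<in>upper_half_plane. J' (half_plane_map (\<sigma>' j) (F z)) = K z)"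
      if "x \<in> upper_half_plane" "y \<in> upper_half_plane" "J' (half_plane_map (\<sigma>' j) x) = K y" for x y
      by (rule v.lift_through_cusp_map[OF ij(2) K that])
    show "J' (half_plane_map (\<sigma>' j) x) = K y"
      if "x \<in> upper_half_plane" "y \<in> upper_half_plane"
        "puncture_chart n v j (J' (half_plane_map (\<sigma>' j) x)) = puncture_chart n v j (K y)" for x y
      using v.J_cusp_range[OF ij(2) that(1)] K(2) that(2)
      by (intro puncture_chart_inj[OF _ _ that(3)]) auto
    show "puncture_chart n v j (J' (half_plane_map (\<sigma>' j) x)) = \<Psi> (cusp_q x)"
      if "x \<in> upper_half_plane" for x
      by (rule \<Psi>(4)[OF that])
    show "puncture_chart n v j (K x) = A * \<Phi> (cusp_q x) / (C * \<Phi> (cusp_q x) + D)"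
      if "x \<in> upper_half_plane" for x
      unfolding K_def chart[OF J\<sigma>X[OF that]] \<Phi>(4)[OF that] ..
    show "((\<lambda>q. A * \<Phi> q / (C * \<Phi> q + D)) has_field_derivative A / D * leading_coeff n a i) (at 0)"
      by (rule derivative_eq_intros \<Phi>(3) refl | simp add: \<Phi>(2) D)+
  qed (use \<Phi>(2) \<Psi> v.leading_coeff_nonzero[OF n v ij(2)] in auto)
qed

text \<open>The inequality for \<open>m\<close> and the one for its inverse \<open>l\<close>. In particular the modulus of a leading
  coefficient does not depend on the choice of the uniformization.\<close>

lemma leading_coeff_transform:
  assumes uw: "uniformization n w \<Gamma> S z J \<sigma> a" and uv: "uniformization n v \<Gamma>' S' z' J' \<sigma>' a'"
    and n: "n > 3" and w: "w \<in> moduli n" and v: "v \<in> moduli n" and ij: "i \<in> {1..n}" "j \<in> {1..n}"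
    and m: "m holomorphic_on punctured_plane n w" "m \<in> punctured_plane n w \<rightarrow> punctured_plane n v"
    and l: "l holomorphic_on punctured_plane n v" "l \<in> punctured_plane n v \<rightarrow> punctured_plane n w"
    and ml: "\<And>\<zeta>. \<zeta> \<in> punctured_plane n v \<Longrightarrow> m (l \<zeta>) = \<zeta>"
    and chart: "\<And>\<zeta>. \<zeta> \<in> punctured_plane n w \<Longrightarrow>
      C * puncture_chart n w i \<zeta> + 1 \<noteq> 0 \<and>
      puncture_chart n v j (m \<zeta>) =
        A * puncture_chart n w i \<zeta> / (C * puncture_chart n w i \<zeta> + 1)" and A: "A \<noteq> 0"
  shows "cmod (leading_coeff n a' j) = cmod A * cmod (leading_coeff n a i)"
proof (rule antisym)
  have "cmod (A / 1 * leading_coeff n a i) \<le> cmod (leading_coeff n a' j)"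
    by (rule leading_coeff_le[OF uw uv n v ij m]) (use chart in auto)
  then show "cmod A * cmod (leading_coeff n a i) \<le> cmod (leading_coeff n a' j)"
    by (simp add: norm_mult)
  have "cmod (1 / A * leading_coeff n a' j) \<le> cmod (leading_coeff n a i)"
  proof (rule leading_coeff_le[OF uv uw n w ij(2,1) l])
    fix \<zeta> assume \<zeta>: "\<zeta> \<in> punctured_plane n v"
    define x y where "x = puncture_chart n w i (l \<zeta>)" and "y = puncture_chart n v j \<zeta>"
    have "l \<zeta> \<in> punctured_plane n w" using l(2) \<zeta> by blast
    from chart[OF this] have *: "C * x + 1 \<noteq> 0" "y = A * x / (C * x + 1)"
      using ml[OF \<zeta>] by (simp_all add: x_def y_def)
    then have "A - C * y = A / (C * x + 1)"
      by (simp add: field_simps)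
    then have "y / (A - C * y) = x"
      using * A by simp
    then show "puncture_chart n w i (l \<zeta>) =
        1 * puncture_chart n v j \<zeta> / (- C * puncture_chart n v j \<zeta> + A)"
      by (simp add: x_def y_def)
  qed (rule A)
  then show "cmod (leading_coeff n a' j) \<le> cmod A * cmod (leading_coeff n a i)"
    using A by (simp add: norm_mult norm_divide divide_le_eq mult.commute)
qed

section \<open>Relabelling the punctures\<close>

lemma puncture_special:
  assumes "n > 3"
  shows "puncture n w n = None" "puncture n w (n - 1) = Some 1" "puncture n w (n - 2) = Some 0"
  using assms by (auto simp: puncture_def)

lemma puncture_generic: "n > 3 \<Longrightarrow> i \<in> {1..n-3} \<Longrightarrow> puncture n w i = Some (w i)"
  by (auto simp: puncture_def)

text \<open>The geometric form of \<open>symm_act n p w = v\<close>: some Moebius map takes the \<open>i\<close>-th puncture of \<open>w\<close> to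
  the \<open>p i\<close>-th puncture of \<open>v\<close>. Since the last three punctures are normalized on both sides, this
  determines the map and the point \<open>v\<close>; compatibility with composition is then immediate.\<close>

definition relabels ::
  "nat \<Rightarrow> (nat \<Rightarrow> nat) \<Rightarrow> (nat \<Rightarrow> complex) \<Rightarrow> (nat \<Rightarrow> complex) \<Rightarrow> bool" where
  "relabels n p w v \<longleftrightarrow> v \<in> moduli n \<and>
     (\<exists>M\<in>Moebius_maps. \<forall>i\<in>{1..n}. puncture n v (p i) = M (puncture n w i))"

lemma relabels_symm_act:
  assumes n: "n > 3" and p: "p permutes {1..n}" and R: "relabels n p w v"
  shows "symm_act n p w = v"
proof -
  obtain M where M: "M \<in> Moebius_maps" "\<And>i. i \<in> {1..n} \<Longrightarrow> puncture n v (p i) = M (puncture n w i)"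
    and v: "v \<in> moduli n"
    using R by (auto simp: relabels_def)
  have Mx: "M (relabel n p w i) = puncture n v i" if "i \<in> {1..n}" for i
    using M(2)[of "inv_into UNIV p i"] permutes_in_image[OF permutes_inv[OF p]] permutes_inverses(1)[OF p] that
    by (simp add: relabel_def)
  have special: "M (relabel n p w (n - 2)) = Some 0" "M (relabel n p w (n - 1)) = Some 1"
      "M (relabel n p w n) = None"
    using n Mx[of "n - 2"] Mx[of "n - 1"] Mx[of n] puncture_special[OF n, of v] by auto
  have ren: "renormalization (relabel n p w) n = M"
    unfolding renormalization_def
    by (rule the_equality) (use M(1) special Moebius_maps_eqI in blast)+
  have "symm_act n p w i = v i" for i
  proof (cases "i \<in> {1..n-3}")
    case True
    then have "i \<in> {1..n}" by auto
    with True show ?thesis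
      using Mx[of i] puncture_generic[OF n True, of v] by (simp add: symm_act_def ren)
  next
    case False
    then have "v i = undefined"
      using v unfolding moduli_def by (blast dest: PiE_arb)
    with False show ?thesis by (auto simp: symm_act_def)
  qed
  then show ?thesis by blast
qed

lemma relabels_id: "w \<in> moduli n \<Longrightarrow> relabels n id w w"
  unfolding relabels_def Moebius_maps_def
  by (intro conjI bexI[of _ id] CollectI exI[of _ 1] exI[of _ 0]) (simp_all add: moebius_scalar)

lemma relabels_comp:
  assumes "p' permutes {1..n}" "relabels n p' w w'" "relabels n p w' w''"
  shows "relabels n (p \<circ> p') w w''"
proof -
  obtain M' where M': "M' \<in> Moebius_maps" "\<And>i. i \<in> {1..n} \<Longrightarrow> puncture n w' (p' i) = M' (puncture n w i)"
    using assms(2) by (auto simp: relabels_def)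
  obtain M where M: "M \<in> Moebius_maps" "\<And>i. i \<in> {1..n} \<Longrightarrow> puncture n w'' (p i) = M (puncture n w' i)"
    and w'': "w'' \<in> moduli n"
    using assms(3) by (auto simp: relabels_def)
  have "puncture n w'' ((p \<circ> p') i) = (M \<circ> M') (puncture n w i)" if "i \<in> {1..n}" for i
    using M(2)[of "p' i"] M'(2)[OF that] permutes_in_image[OF assms(1)] that by simp
  then show ?thesis
    unfolding relabels_def using w'' Moebius_maps_comp[OF M(1) M'(1)] by blast
qed

lemma mem_punctured_plane_iff:
  assumes "n > 3"
  shows "\<zeta> \<in> punctured_plane n w \<longleftrightarrow> (\<forall>j\<in>{1..n}. Some \<zeta> \<noteq> puncture n w j)"
proof
  assume *: "\<zeta> \<in> punctured_plane n w"
  show "\<forall>j\<in>{1..n}. Some \<zeta> \<noteq> puncture n w j"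
  proof
    fix j assume "j \<in> {1..n}"
    then consider "j = n" | "j = n - 1" | "j = n - 2" | "j \<in> {1..n-3}" by fastforce
    then show "Some \<zeta> \<noteq> puncture n w j"
      using * by cases (auto simp: puncture_def)
  qed
next
  assume *: "\<forall>j\<in>{1..n}. Some \<zeta> \<noteq> puncture n w j"
  have "n - 1 \<in> {1..n}" "n - 2 \<in> {1..n}" using assms by auto
  with * have "\<zeta> \<noteq> 1" "\<zeta> \<noteq> 0"
    using puncture_special[OF assms, of w] by metis+
  moreover have "\<zeta> \<noteq> w j" if "j \<in> {1..n-3}" for j
  proof -
    have "j \<in> {1..n}" using that by auto
    with * have "Some \<zeta> \<noteq> puncture n w j" by blast
    then show ?thesis using puncture_generic[OF assms that, of w] by simp
  qed
  ultimately show "\<zeta> \<in> punctured_plane n w" by blast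
qed

context
  fixes n :: nat and w :: "nat \<Rightarrow> complex" and k :: nat
  assumes n: "n > 3" and w: "w \<in> moduli n" and k: "k \<in> {1..n-1}"
begin

text \<open>The map \<open>swap_map\<close>, that is \<open>\<zeta> \<mapsto> swap_limit + swap_residue / (\<zeta> - swap_pole)\<close>, sends the \<open>k\<close>-th puncture to
  infinity and infinity to \<open>swap_limit\<close>. The values of \<open>swap_limit\<close> and \<open>swap_residue\<close> are the ones for which
  the images of those punctures that receive the labels \<open>n - 2\<close> and \<open>n - 1\<close> are 0 and 1.\<close>

definition swap_pole where "swap_pole = the (puncture n w k)"
definition swap_residue where
  "swap_residue = (if k = n - 1 \<or> k = n - 2 then 1 else w k * (1 - w k))"
definition swap_limit where
  "swap_limit = (if k = n - 1 then 1 else if k = n - 2 then 0 else 1 - w k)"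
definition swap_map where "swap_map \<zeta> = swap_limit + swap_residue / (\<zeta> - swap_pole)"
definition swap_inverse where "swap_inverse \<zeta> = swap_pole + swap_residue / (\<zeta> - swap_limit)"
definition swap_moebius where
  "swap_moebius = moebius swap_limit (swap_residue - swap_limit * swap_pole) 1 (- swap_pole)"
definition swap_point where
  "swap_point = (\<lambda>i\<in>{1..n-3}. the (swap_moebius (puncture n w (Transposition.transpose k n i))))"

lemma k_generic: "k \<noteq> n - 1 \<Longrightarrow> k \<noteq> n - 2 \<Longrightarrow> k \<in> {1..n-3}"
  using k by auto

lemma swapped_labels: "k \<in> {1..n}" "n \<in> {1..n}" "k \<noteq> n"
  using k n by auto

lemma swap_residue_nonzero: "swap_residue \<noteq> 0"
  using moduli_value[OF w] k_generic by (auto simp: swap_residue_def)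

lemma puncture_swap_pole: "puncture n w k = Some swap_pole"
  unfolding swap_pole_def by (rule puncture_finite[OF k])

lemma swap_pole_eq: "swap_pole = (if k = n - 1 then 1 else if k = n - 2 then 0 else w k)"
  using puncture_swap_pole n k by (auto simp: puncture_def split: if_splits)

lemma swap_moebius:
  "swap_moebius None = Some swap_limit"
  "swap_moebius (Some swap_pole) = None"
  "\<zeta> \<noteq> swap_pole \<Longrightarrow> swap_moebius (Some \<zeta>) = Some (swap_map \<zeta>)"
  by (auto simp: swap_moebius_def moebius_def swap_map_def field_simps)

lemma swap_moebius_Moebius: "swap_moebius \<in> Moebius_maps"
proof -
  have "swap_limit * (- swap_pole) - (swap_residue - swap_limit * swap_pole) * 1 \<noteq> 0"
    using swap_residue_nonzero by (simp add: algebra_simps)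
  then show ?thesis
    unfolding swap_moebius_def Moebius_maps_def by blast
qed

lemma swap_moebius_inj: "swap_moebius x = swap_moebius y \<longleftrightarrow> x = y"
  using Moebius_maps_inverse[OF swap_moebius_Moebius] by metis

lemma transpose_label: "i \<in> {1..n} \<Longrightarrow> Transposition.transpose k n i \<in> {1..n}"
  using swapped_labels by (cases "i = k"; cases "i = n") auto

lemma puncture_swap_point:
  assumes i: "i \<in> {1..n}"
  shows "puncture n swap_point i = swap_moebius (puncture n w (Transposition.transpose k n i))"
proof -
  consider "i = n" | "i = n - 1" | "i = n - 2" | "i \<in> {1..n-3}" using i by fastforce
  then show ?thesis
  proof cases
    case 1
    then show ?thesis
      using puncture_special[OF n, of swap_point] by (simp add: puncture_swap_pole swap_moebius(2))
  next
    case 2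
    show ?thesis
    proof (cases "i = k")
      case True
      moreover have "swap_limit = 1"
        using True 2 n unfolding swap_limit_def by auto
      ultimately show ?thesis
        using puncture_special[OF n] 2 by (simp add: swap_moebius(1) del: One_nat_def)
    next
      case False
      then have "Transposition.transpose k n i = i" using n 2 by auto
      moreover have "1 \<noteq> swap_pole" "swap_map 1 = 1"
        using False 2 moduli_value[OF w] k_generic n
        unfolding swap_pole_eq swap_map_def swap_limit_def swap_residue_def
        by (auto simp: field_simps)
      ultimately show ?thesis
        using puncture_special[OF n] 2 by (simp add: swap_moebius(3) del: One_nat_def)
    qed
  next
    case 3
    show ?thesis
    proof (cases "i = k")
      case True
      moreover have "swap_limit = 0"
        using True 3 n unfolding swap_limit_def by auto
      ultimately show ?thesis
        using puncture_special[OF n] 3 by (simp add: swap_moebius(1) del: One_nat_def)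
    next
      case False
      then have "Transposition.transpose k n i = i" using n 3 by auto
      moreover have "0 \<noteq> swap_pole" "swap_map 0 = 0"
        using False 3 moduli_value[OF w] k_generic n
        unfolding swap_pole_eq swap_map_def swap_limit_def swap_residue_def
        by (auto simp: field_simps)
      ultimately show ?thesis
        using puncture_special[OF n] 3 by (simp add: swap_moebius(3) del: One_nat_def)
    qed
  next
    case 4
    have "i \<noteq> n" using 4 n by auto
    then have "Transposition.transpose k n i \<noteq> k"
      using swapped_labels by (metis transpose_apply_second transpose_involutory)
    then have "puncture n w (Transposition.transpose k n i) \<noteq> Some swap_pole"
      using puncture_eq_iff[OF w n transpose_label[OF i] swapped_labels(1)] puncture_swap_pole by simp
    then have "swap_moebius (puncture n w (Transposition.transpose k n i)) \<noteq> None"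
      using swap_moebius_inj swap_moebius(2) by metis
    then show ?thesis
      using puncture_generic[OF n 4, of swap_point] 4 by (auto simp: swap_point_def)
  qed
qed

lemma puncture_swap_point_eq_iff:
  assumes "i \<in> {1..n}" "j \<in> {1..n}"
  shows "puncture n swap_point i = puncture n swap_point j \<longleftrightarrow> i = j"
  using puncture_swap_point[OF assms(1)] puncture_swap_point[OF assms(2)]
    puncture_eq_iff[OF w n transpose_label[OF assms(1)] transpose_label[OF assms(2)]] swap_moebius_inj
  by (simp add: inj_eq[OF inj_transpose])

lemma swap_point_moduli: "swap_point \<in> moduli n"
proof -
  note fin = puncture_generic[OF n, of _ swap_point]
  have le: "i \<in> {1..n}" "i \<noteq> n - 1" "i \<noteq> n - 2" if "i \<in> {1..n-3}" for i
    using that n by auto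
  have special: "puncture n swap_point (n - 1) = Some 1" "puncture n swap_point (n - 2) = Some 0"
    "n - 1 \<in> {1..n}" "n - 2 \<in> {1..n}"
    using n puncture_special[OF n] by auto
  have "swap_point i \<noteq> 1 \<and> swap_point i \<noteq> 0" if "i \<in> {1..n-3}" for i
  proof -
    have "puncture n swap_point i \<noteq> puncture n swap_point (n - 1)"
      "puncture n swap_point i \<noteq> puncture n swap_point (n - 2)"
      using puncture_swap_point_eq_iff[OF le(1)[OF that] special(3)]
        puncture_swap_point_eq_iff[OF le(1)[OF that] special(4)] le(2,3)[OF that] by blast+
    then show ?thesis
      unfolding fin[OF that] special by blast
  qed
  moreover have "inj_on swap_point {1..n-3}"
  proof (rule inj_onI)
    fix i j assume ij: "i \<in> {1..n-3}" "j \<in> {1..n-3}" "swap_point i = swap_point j"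
    then have "puncture n swap_point i = puncture n swap_point j"
      by (simp only: fin)
    then show "i = j"
      using puncture_swap_point_eq_iff[OF le(1)[OF ij(1)] le(1)[OF ij(2)]] by blast
  qed
  ultimately show ?thesis
    by (auto simp: moduli_def swap_point_def)
qed

lemma relabels_swap: "relabels n (Transposition.transpose k n) w swap_point"
  unfolding relabels_def
proof (intro conjI swap_point_moduli bexI[OF _ swap_moebius_Moebius] ballI)
  fix i assume i: "i \<in> {1..n}"
  then show "puncture n swap_point (Transposition.transpose k n i) = swap_moebius (puncture n w i)"
    using puncture_swap_point[OF transpose_label[OF i]] by simp
qed

lemma not_swap_pole: "\<zeta> \<in> punctured_plane n w \<Longrightarrow> \<zeta> \<noteq> swap_pole"
  using mem_punctured_plane_iff[OF n] puncture_swap_pole swapped_labels(1) by metis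

lemma not_swap_limit: "\<zeta> \<in> punctured_plane n swap_point \<Longrightarrow> \<zeta> \<noteq> swap_limit"
proof -
  assume "\<zeta> \<in> punctured_plane n swap_point"
  moreover have "puncture n swap_point k = Some swap_limit"
    using puncture_swap_point[OF swapped_labels(1)] by (simp add: puncture_def[of n w] swap_moebius)
  ultimately show ?thesis
    using mem_punctured_plane_iff[OF n] swapped_labels(1) by metis
qed

lemma swap_map_swap_inverse: "\<zeta> \<noteq> swap_limit \<Longrightarrow> swap_map (swap_inverse \<zeta>) = \<zeta>"
  using swap_residue_nonzero by (simp add: swap_map_def swap_inverse_def)

lemma swap_map_range: "swap_map \<in> punctured_plane n w \<rightarrow> punctured_plane n swap_point"
proof
  fix \<zeta> assume \<zeta>: "\<zeta> \<in> punctured_plane n w"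
  have "Some (swap_map \<zeta>) \<noteq> puncture n swap_point j" if j: "j \<in> {1..n}" for j
  proof -
    have "Some \<zeta> \<noteq> puncture n w (Transposition.transpose k n j)"
      using \<zeta> mem_punctured_plane_iff[OF n] transpose_label[OF j] by blast
    then show ?thesis
      using swap_moebius(3)[OF not_swap_pole[OF \<zeta>]] puncture_swap_point[OF j] swap_moebius_inj by metis
  qed
  then show "swap_map \<zeta> \<in> punctured_plane n swap_point"
    unfolding mem_punctured_plane_iff[OF n] by blast
qed

lemma swap_inverse_range: "swap_inverse \<in> punctured_plane n swap_point \<rightarrow> punctured_plane n w"
proof
  fix \<zeta> assume \<zeta>: "\<zeta> \<in> punctured_plane n swap_point"
  note ne = not_swap_limit[OF \<zeta>]
  have "swap_inverse \<zeta> \<noteq> swap_pole"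
    using ne swap_residue_nonzero by (simp add: swap_inverse_def)
  then have M: "swap_moebius (Some (swap_inverse \<zeta>)) = Some \<zeta>"
    by (simp add: swap_moebius swap_map_swap_inverse[OF ne])
  have "Some (swap_inverse \<zeta>) \<noteq> puncture n w j" if j: "j \<in> {1..n}" for j
  proof
    assume "Some (swap_inverse \<zeta>) = puncture n w j"
    then have "Some \<zeta> = puncture n swap_point (Transposition.transpose k n j)"
      using puncture_swap_point[OF transpose_label[OF j]] M by simp
    then show False
      using \<zeta> mem_punctured_plane_iff[OF n] transpose_label[OF j] by blast
  qed
  then show "swap_inverse \<zeta> \<in> punctured_plane n w"
    unfolding mem_punctured_plane_iff[OF n] by blast
qed

text \<open>The derivative of \<open>swap_map\<close> at the \<open>i\<close>-th puncture in the coordinates \<open>puncture_chart\<close> of the two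
  points.\<close>

definition swap_multiplier where
  "swap_multiplier i = (if i = k then 1 / swap_residue else if i = n then swap_residue
     else - swap_residue / (the (puncture n w i) - swap_pole)\<^sup>2)"

lemma puncture_ne_swap_pole:
  assumes "i \<in> {1..n}" "i \<noteq> k" "i \<noteq> n"
  shows "puncture n w i = Some (the (puncture n w i))" "the (puncture n w i) \<noteq> swap_pole"
proof -
  have "i \<in> {1..n-1}" using assms by auto
  then show fin: "puncture n w i = Some (the (puncture n w i))"
    by (rule puncture_finite)
  then show "the (puncture n w i) \<noteq> swap_pole"
    using puncture_eq_iff[OF w n assms(1) swapped_labels(1)] assms(2) puncture_swap_pole by metis
qed

lemma swap_multiplier_nonzero: "i \<in> {1..n} \<Longrightarrow> swap_multiplier i \<noteq> 0"
  using swap_residue_nonzero puncture_ne_swap_pole(2) by (auto simp: swap_multiplier_def)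

lemma swap_chart:
  assumes i: "i \<in> {1..n}"
  shows "\<exists>C. \<forall>\<zeta>\<in>punctured_plane n w. C * puncture_chart n w i \<zeta> + 1 \<noteq> 0 \<and>
    puncture_chart n swap_point (Transposition.transpose k n i) (swap_map \<zeta>) =
      swap_multiplier i * puncture_chart n w i \<zeta> / (C * puncture_chart n w i \<zeta> + 1)"
proof -
  note \<delta> = swap_residue_nonzero
  consider "i = k" | "i = n" | "i \<noteq> k" "i \<noteq> n" by blast
  then show ?thesis
  proof cases
    case 1
    show ?thesis
    proof (rule exI[of _ "swap_limit / swap_residue"], intro ballI)
      fix \<zeta> assume \<zeta>: "\<zeta> \<in> punctured_plane n w"
      note s = not_swap_pole[OF \<zeta>]
      have "swap_map \<zeta> \<noteq> 0" using swap_map_range \<zeta> by blast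
      moreover have "swap_limit / swap_residue * (\<zeta> - swap_pole) + 1 =
          swap_map \<zeta> * ((\<zeta> - swap_pole) / swap_residue)"
        using s \<delta> by (simp add: swap_map_def field_simps)
      moreover have "puncture_chart n w i \<zeta> = \<zeta> - swap_pole"
        using swapped_labels by (simp add: 1 puncture_chart_def swap_pole_def)
      moreover have "puncture_chart n swap_point (Transposition.transpose k n i) \<xi> = 1 / \<xi>" for \<xi>
        by (simp add: 1 puncture_chart_def)
      moreover have "swap_multiplier i = 1 / swap_residue"
        by (simp add: 1 swap_multiplier_def)
      ultimately show "swap_limit / swap_residue * puncture_chart n w i \<zeta> + 1 \<noteq> 0 \<and>
          puncture_chart n swap_point (Transposition.transpose k n i) (swap_map \<zeta>) =
          swap_multiplier i * puncture_chart n w i \<zeta> /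
            (swap_limit / swap_residue * puncture_chart n w i \<zeta> + 1)"
        using s \<delta> by simp
    qed
  next
    case 2
    show ?thesis
    proof (rule exI[of _ "- swap_pole"], intro ballI)
      fix \<zeta> assume \<zeta>: "\<zeta> \<in> punctured_plane n w"
      note s = not_swap_pole[OF \<zeta>]
      have "\<zeta> \<noteq> 0" using \<zeta> by auto
      have "puncture n swap_point k = Some swap_limit"
        using puncture_swap_point[OF swapped_labels(1)] by (simp add: puncture_def[of n w] swap_moebius)
      then have "puncture_chart n swap_point (Transposition.transpose k n i) (swap_map \<zeta>) =
          swap_residue / (\<zeta> - swap_pole)"
        using swapped_labels by (simp add: 2 puncture_chart_def swap_map_def)
      moreover have "- swap_pole * (1 / \<zeta>) + 1 = (\<zeta> - swap_pole) / \<zeta>"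
        using \<open>\<zeta> \<noteq> 0\<close> by (simp add: field_simps)
      moreover have "puncture_chart n w i \<zeta> = 1 / \<zeta>" "swap_multiplier i = swap_residue"
        using swapped_labels by (simp_all add: 2 puncture_chart_def swap_multiplier_def)
      ultimately show "- swap_pole * puncture_chart n w i \<zeta> + 1 \<noteq> 0 \<and>
          puncture_chart n swap_point (Transposition.transpose k n i) (swap_map \<zeta>) =
          swap_multiplier i * puncture_chart n w i \<zeta> / (- swap_pole * puncture_chart n w i \<zeta> + 1)"
        using s \<open>\<zeta> \<noteq> 0\<close> by simp
    qed
  next
    case 3
    define p where "p = the (puncture n w i)"
    have p: "puncture n w i = Some p" "p - swap_pole \<noteq> 0"
      using puncture_ne_swap_pole[OF i 3] by (simp_all add: p_def)
    show ?thesis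
    proof (rule exI[of _ "1 / (p - swap_pole)"], intro ballI)
      fix \<zeta> assume \<zeta>: "\<zeta> \<in> punctured_plane n w"
      have s: "\<zeta> - swap_pole \<noteq> 0" using not_swap_pole[OF \<zeta>] by simp
      have ti: "Transposition.transpose k n i = i" using 3 by simp
      have "puncture n swap_point i = Some (swap_map p)"
        using puncture_swap_point[OF i] p by (simp add: ti swap_moebius)
      then have "puncture_chart n swap_point (Transposition.transpose k n i) (swap_map \<zeta>) =
          swap_residue / (\<zeta> - swap_pole) - swap_residue / (p - swap_pole)"
        using 3 by (simp add: ti puncture_chart_def swap_map_def)
      also have "\<dots> = - swap_residue * (\<zeta> - p) / ((\<zeta> - swap_pole) * (p - swap_pole))"
        using s p(2) by (simp add: divide_simps) (simp add: algebra_simps)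
      finally have "puncture_chart n swap_point (Transposition.transpose k n i) (swap_map \<zeta>) =
        - swap_residue * (\<zeta> - p) / ((\<zeta> - swap_pole) * (p - swap_pole))" .
      moreover have "1 / (p - swap_pole) * (\<zeta> - p) + 1 = (\<zeta> - swap_pole) / (p - swap_pole)"
        using p(2) by (simp add: field_simps)
      moreover have "puncture_chart n w i \<zeta> = \<zeta> - p"
        "swap_multiplier i = - swap_residue / (p - swap_pole)\<^sup>2"
        using 3 by (simp_all add: puncture_chart_def swap_multiplier_def p_def)
      ultimately show "1 / (p - swap_pole) * puncture_chart n w i \<zeta> + 1 \<noteq> 0 \<and>
          puncture_chart n swap_point (Transposition.transpose k n i) (swap_map \<zeta>) =
          swap_multiplier i * puncture_chart n w i \<zeta> / (1 / (p - swap_pole) * puncture_chart n w i \<zeta> + 1)"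
        using s p(2) by (simp add: power2_eq_square)
    qed
  qed
qed

lemma leading_coeff_swap:
  assumes "uniformization n w \<Gamma> S z J \<sigma> a" "uniformization n swap_point \<Gamma>' S' z' J' \<sigma>' a'"
    and i: "i \<in> {1..n}"
  shows "cmod (leading_coeff n a' (Transposition.transpose k n i)) =
    cmod (swap_multiplier i) * cmod (leading_coeff n a i)"
proof -
  obtain C where C: "\<And>\<zeta>. \<zeta> \<in> punctured_plane n w \<Longrightarrow> C * puncture_chart n w i \<zeta> + 1 \<noteq> 0 \<and>
    puncture_chart n swap_point (Transposition.transpose k n i) (swap_map \<zeta>) =
      swap_multiplier i * puncture_chart n w i \<zeta> / (C * puncture_chart n w i \<zeta> + 1)"
    using swap_chart[OF i] by blast
  have "swap_map holomorphic_on punctured_plane n w"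
    unfolding swap_map_def using not_swap_pole by (intro holomorphic_intros) auto
  moreover have "swap_inverse holomorphic_on punctured_plane n swap_point"
    unfolding swap_inverse_def using not_swap_limit by (intro holomorphic_intros) auto
  ultimately show ?thesis
    by (rule leading_coeff_transform[OF assms(1,2) n w swap_point_moduli i transpose_label[OF i]
          _ swap_map_range _ swap_inverse_range _ C swap_multiplier_nonzero[OF i]])
      (rule swap_map_swap_inverse, rule not_swap_limit)
qed

text \<open>The multipliers of the labels \<open>k\<close> and \<open>n\<close> are reciprocal. For \<open>k \<le> n - 3\<close> those of the labels
  \<open>n - 2\<close> and \<open>n - 1\<close> are \<open>(w\<^sub>k - 1) / w\<^sub>k\<close> and \<open>w\<^sub>k / (w\<^sub>k - 1)\<close>, with product 1. What remains
  is, up to signs and factor by factor, the reciprocal of \<open>f\<close> on the transposition.\<close>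

lemma prod_swap_multiplier:
  "(\<Prod>i\<in>{1..n}. cmod (swap_multiplier i)) * cmod (transposition_factor n k w) = 1"
proof -
  define \<mu> where "\<mu> x = cmod swap_residue / (cmod (x - swap_pole))\<^sup>2" for x
  define A where "A = {1..n-1} - {k}"
  have A: "{1..n} = insert n (insert k A)" "finite A" "k \<notin> A" "n \<notin> insert k A"
    using k n by (auto simp: A_def)
  have "(\<Prod>i\<in>{1..n}. cmod (swap_multiplier i)) =
      (\<Prod>i\<in>{1..n-1} - {k}. cmod (swap_multiplier i))"
  proof -
    have "cmod (swap_multiplier n) * cmod (swap_multiplier k) = 1"
      using swap_residue_nonzero swapped_labels(3) by (simp add: swap_multiplier_def norm_divide)
    then show ?thesis
      unfolding A_def[symmetric] A(1) using A(2-4) by (simp add: mult.assoc[symmetric])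
  qed
  also have "\<dots> = (\<Prod>i\<in>{1..n-1} - {k}. \<mu> (the (puncture n w i)))"
    using n by (intro prod.cong refl) (auto simp: swap_multiplier_def \<mu>_def norm_divide norm_power)
  also have "\<dots> * cmod (transposition_factor n k w) = 1"
  proof -
    have fin: "the (puncture n w i) = w i" if "i \<in> {1..n-3}" for i
      using that n by (auto simp: puncture_def)
    have special: "the (puncture n w (n - 1)) = 1" "the (puncture n w (n - 2)) = 0"
      using n by (auto simp: puncture_def)
    have ne: "w i \<noteq> swap_pole" if "i \<in> {1..n-3}" "i \<noteq> k" for i
    proof -
      have "i \<in> {1..n}" "i \<noteq> n" using that(1) n by auto
      then show ?thesis
        using puncture_ne_swap_pole(2)[of i] fin[OF that(1)] that(2) by simp
    qed
    consider "k = n - 1" | "k = n - 2" | "k \<in> {1..n-3}" using k_generic by blast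
    then show ?thesis
    proof cases
      case 1
      have \<delta>: "swap_residue = 1" and s: "swap_pole = 1"
        unfolding swap_residue_def swap_pole_eq using 1 n by auto
      have "{1..n-1} - {k} = insert (n - 2) {1..n-3}" using 1 n by auto
      moreover have "n - 2 \<notin> {1..n-3}" using n by auto
      ultimately have "(\<Prod>i\<in>{1..n-1} - {k}. \<mu> (the (puncture n w i))) = \<mu> 0 * (\<Prod>i\<in>{1..n-3}. \<mu> (w i))"
        by (simp add: special fin del: One_nat_def)
      moreover have "\<mu> (w i) * cmod ((w i - 1)\<^sup>2) = 1" if "i \<in> {1..n-3}" for i
        using moduli_value[OF w that] by (simp add: \<mu>_def \<delta> s norm_power)
      then have "(\<Prod>i\<in>{1..n-3}. \<mu> (w i)) * cmod (\<Prod>i\<in>{1..n-3}. (w i - 1)\<^sup>2) = 1"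
        unfolding prod_norm[symmetric] prod.distrib[symmetric] by (intro prod.neutral ballI)
      moreover have "\<mu> 0 = 1" by (simp add: \<mu>_def \<delta> s)
      ultimately show ?thesis using 1 by (simp add: transposition_factor_def)
    next
      case 2
      have \<delta>: "swap_residue = 1" and s: "swap_pole = 0"
        unfolding swap_residue_def swap_pole_eq using 2 n by auto
      have "{1..n-1} - {k} = insert (n - 1) {1..n-3}" using 2 n by auto
      moreover have "n - 1 \<notin> {1..n-3}" using n by auto
      ultimately have "(\<Prod>i\<in>{1..n-1} - {k}. \<mu> (the (puncture n w i))) = \<mu> 1 * (\<Prod>i\<in>{1..n-3}. \<mu> (w i))"
        by (simp add: special fin del: One_nat_def)
      moreover have "\<mu> (w i) * cmod ((w i)\<^sup>2) = 1" if "i \<in> {1..n-3}" for i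
        using moduli_value[OF w that] by (simp add: \<mu>_def \<delta> s norm_power)
      then have "(\<Prod>i\<in>{1..n-3}. \<mu> (w i)) * cmod (\<Prod>i\<in>{1..n-3}. (w i)\<^sup>2) = 1"
        unfolding prod_norm[symmetric] prod.distrib[symmetric] by (intro prod.neutral ballI)
      moreover have "\<mu> 1 = 1" by (simp add: \<mu>_def \<delta> s)
      ultimately show ?thesis using 2 n by (auto simp: transposition_factor_def)
    next
      case 3
      then have kn: "k \<noteq> n - 1" "k \<noteq> n - 2" using n by auto
      then have \<delta>: "swap_residue = w k * (1 - w k)" and s: "swap_pole = w k"
        by (simp_all add: swap_residue_def swap_pole_eq)
      note wk = moduli_value[OF w 3]
      define B where "B = {1..n-3} - {k}"
      have B: "{1..n-1} - {k} = insert (n - 1) (insert (n - 2) B)" "finite (insert (n - 2) B)" "finite B"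
        "n - 1 \<notin> insert (n - 2) B" "n - 2 \<notin> B"
        using 3 n by (auto simp: B_def)
      have "(\<Prod>i\<in>{1..n-1} - {k}. \<mu> (the (puncture n w i))) =
          (\<mu> 1 * \<mu> 0) * (\<Prod>i\<in>B. \<mu> (the (puncture n w i)))"
        by (simp only: B(1) prod.insert[OF B(2,4)] prod.insert[OF B(3,5)] special mult.assoc)
      also have "(\<Prod>i\<in>B. \<mu> (the (puncture n w i))) = (\<Prod>i\<in>{1..n-3} - {k}. \<mu> (w i))"
        using fin unfolding B_def by (intro prod.cong) auto
      finally have "(\<Prod>i\<in>{1..n-1} - {k}. \<mu> (the (puncture n w i))) =
          (\<mu> 1 * \<mu> 0) * (\<Prod>i\<in>{1..n-3} - {k}. \<mu> (w i))" .
      moreover have "\<mu> 1 * \<mu> 0 = 1"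
      proof -
        have "\<mu> 1 = cmod (w k) * cmod (1 - w k) / (cmod (1 - w k))\<^sup>2"
          "\<mu> 0 = cmod (w k) * cmod (1 - w k) / (cmod (w k))\<^sup>2"
          by (simp_all add: \<mu>_def \<delta> s norm_mult)
        moreover have "cmod (w k) \<noteq> 0" "cmod (1 - w k) \<noteq> 0" using wk by auto
        ultimately show ?thesis by (simp add: power2_eq_square)
      qed
      moreover have "\<mu> (w i) * cmod ((w i - w k)\<^sup>2 / (w k * (w k - 1))) = 1"
        if "i \<in> {1..n-3} - {k}" for i
        using ne[of i] that wk
        by (simp add: \<mu>_def \<delta> s norm_mult norm_divide norm_power norm_minus_commute[of 1])
      then have "(\<Prod>i\<in>{1..n-3} - {k}. \<mu> (w i)) *
          cmod (\<Prod>i\<in>{1..n-3} - {k}. (w i - w k)\<^sup>2 / (w k * (w k - 1))) = 1"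
        unfolding prod_norm[symmetric] prod.distrib[symmetric] by (intro prod.neutral ballI)
      ultimately show ?thesis using kn by (simp add: transposition_factor_def)
    qed
  qed
  finally show ?thesis .
qed

end

section \<open>The Hermitian metric\<close>

definition cusp_product :: "nat \<Rightarrow> ((nat \<Rightarrow> complex) \<Rightarrow> nat \<Rightarrow> int \<Rightarrow> complex) \<Rightarrow> (nat \<Rightarrow> complex) \<Rightarrow> real" where
  "cusp_product n a w = (\<Prod>i\<in>{1..n-1}. cusp_h n a i w) / cusp_h n a n w"

lemma cusp_h_leading_coeff:
  assumes "i \<in> {1..n-1}"
  shows "cusp_h n a i w = (cmod (leading_coeff n (a w) i))\<^sup>2"
  using assms by (auto simp: cusp_h_def leading_coeff_def)

text \<open>The division by \<open>h\<^sub>n\<close> turns into one more factor of the same kind.\<close>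

lemma cusp_product_leading_coeff:
  assumes "n > 0"
  shows "cusp_product n a w = (\<Prod>i\<in>{1..n}. cmod (leading_coeff n (a w) i))\<^sup>2"
proof -
  have ins: "{1..n} = insert n {1..n-1}" "n \<notin> {1..n-1}" "finite {1..n-1}"
    using assms by auto
  have "(\<Prod>i\<in>{1..n-1}. cusp_h n a i w) = (\<Prod>i\<in>{1..n-1}. cmod (leading_coeff n (a w) i))\<^sup>2"
    unfolding prod_power_distrib by (intro prod.cong refl cusp_h_leading_coeff)
  moreover have "1 / cusp_h n a n w = (cmod (leading_coeff n (a w) n))\<^sup>2"
    by (simp add: cusp_h_def leading_coeff_def norm_divide power_divide)
  ultimately show ?thesis
    unfolding cusp_product_def divide_inverse ins(1) prod.insert[OF ins(3,2)] power_mult_distrib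
    by (simp add: inverse_eq_divide)
qed

text \<open>\<open>(a b) = (a n) (b n) (a n)\<close> for \<open>a\<close>, \<open>b\<close> different from \<open>n\<close>.\<close>

lemma transpositions_generate:
  fixes n :: nat
  assumes p: "p permutes {1..n}" and id: "P id"
    and swap: "\<And>k. k \<in> {1..n-1} \<Longrightarrow> P (Transposition.transpose k n)"
    and comp: "\<And>p q. p permutes {1..n} \<Longrightarrow> q permutes {1..n} \<Longrightarrow> P p \<Longrightarrow> P q \<Longrightarrow> P (p \<circ> q)"
  shows "P p"
  using p finite_atLeastAtMost id
proof (rule permutes_induct)
  fix a b q assume ab: "a \<in> {1..n}" "b \<in> {1..n}" "a \<noteq> b" and q: "P q" "q permutes {1..n}"
  have perm: "Transposition.transpose c d permutes {1..n}" if "c \<in> {1..n}" "d \<in> {1..n}" for c d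
    using that by (rule permutes_swap_id)
  have n: "n \<in> {1..n}" using ab by auto
  have less: "c \<in> {1..n-1}" if "c \<in> {1..n}" "c \<noteq> n" for c using that by auto
  have "P (Transposition.transpose a b)"
  proof (cases "a = n \<or> b = n")
    case True
    then show ?thesis
      using swap[OF less[OF ab(1)]] swap[OF less[OF ab(2)]] ab(3) by (metis transpose_commute)
  next
    case False
    then have "Transposition.transpose a b =
        Transposition.transpose a n \<circ> (Transposition.transpose b n \<circ> Transposition.transpose a n)"
      using ab(3) by (simp add: fun_eq_iff transpose_commute[of b n] transpose_triple)
    moreover have "P (Transposition.transpose b n \<circ> Transposition.transpose a n)"
      using False ab n by (intro comp perm swap less) auto
    then have "P (Transposition.transpose a n \<circ> (Transposition.transpose b n \<circ> Transposition.transpose a n))"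
      using False ab n by (intro comp perm swap less permutes_compose) auto
    ultimately show ?thesis by simp
  qed
  then show "P (Transposition.transpose a b \<circ> q)"
    using comp perm[OF ab(1,2)] q by blast
qed

theorem lemma1:
  fixes n :: nat
    and \<Gamma> :: "(nat \<Rightarrow> complex) \<Rightarrow> (sphere \<Rightarrow> sphere) set"
    and S :: "(nat \<Rightarrow> complex) \<Rightarrow> nat \<Rightarrow> sphere \<Rightarrow> sphere"
    and z :: "(nat \<Rightarrow> complex) \<Rightarrow> nat \<Rightarrow> sphere"
    and J :: "(nat \<Rightarrow> complex) \<Rightarrow> complex \<Rightarrow> complex"
    and \<sigma> :: "(nat \<Rightarrow> complex) \<Rightarrow> nat \<Rightarrow> sphere \<Rightarrow> sphere"
    and a :: "(nat \<Rightarrow> complex) \<Rightarrow> nat \<Rightarrow> int \<Rightarrow> complex"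
    and f :: "(nat \<Rightarrow> nat) \<Rightarrow> (nat \<Rightarrow> complex) \<Rightarrow> complex"
  assumes "n > 3"
    and "\<And>w. w \<in> moduli n \<Longrightarrow>
           uniformization n w (\<Gamma> w) (S w) (z w) (J w) (\<sigma> w) (a w)"
    and "\<And>i. i \<in> {1..n} \<Longrightarrow> smooth_on_moduli n (cusp_h n a i)"
    and "bundle_cocycle n f"
  shows "determines_hermitian_metric n f
           (\<lambda>w. (\<Prod>i\<in>{1..n-1}. cusp_h n a i w) / cusp_h n a n w)"
proof -
  note n = assms(1) and unif = assms(2)
  let ?H = "cusp_product n a"
  have n1: "n \<in> {1..n}" "1 \<in> {1..n-1}" "n > 0" using n by auto
  have coeff: "leading_coeff n (a w) i \<noteq> 0" if "w \<in> moduli n" "i \<in> {1..n}" for w i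
    by (rule uniformization.leading_coeff_nonzero[OF unif[OF that(1)] n that])
  have H_pos: "?H w > 0" if "w \<in> moduli n" for w
    unfolding cusp_product_leading_coeff[OF n1(3)] using coeff[OF that]
    by (intro zero_less_power prod_pos) simp
  have h_ne: "cusp_h n a n w \<noteq> 0" if "w \<in> moduli n" for w
    using coeff[OF that n1(1)] by (auto simp: cusp_h_def leading_coeff_def)
  have smooth: "smooth_on_moduli n (\<lambda>w. (\<Prod>i\<in>{1..n-1}. cusp_h n a i w) / cusp_h n a n w)"
  proof (intro smooth_on_moduli_divide smooth_on_moduli_prod)
    show "smooth_on_moduli n (cusp_h n a i)" if "i \<in> {1..n-1}" for i
      using that by (intro assms(3)) auto
  qed (use assms(3) n1(1) h_ne in auto)
  \<comment> \<open>The transformation law at \<open>p\<close>, with \<open>symm_act\<close> replaced by the relation that is easy to compose.\<close>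
  define P where "P p \<longleftrightarrow> (\<forall>w\<in>moduli n. \<exists>v. relabels n p w v \<and> ?H v * (cmod (f p w))\<^sup>2 = ?H w)" for p
  have factor: "f (Transposition.transpose k n) w = transposition_factor n k w"
    if "k \<in> {1..n-1}" "w \<in> moduli n" for k w
    using assms(4) that by (simp add: bundle_cocycle_def)
  have cocycle: "cmod (f (p \<circ> q) w) = cmod (f p (symm_act n q w)) * cmod (f q w)"
    if pq: "p permutes {1..n}" "q permutes {1..n}" and w: "w \<in> moduli n" for p q w
  proof -
    obtain \<epsilon> where "\<epsilon> \<in> {1, -1}" "f (p \<circ> q) w = \<epsilon> * (f p (symm_act n q w) * f q w)"
      using assms(4) w pq unfolding bundle_cocycle_def by meson
    then show ?thesis by (auto simp: norm_mult)
  qed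
  have P_swap: "P (Transposition.transpose k n)" if k: "k \<in> {1..n-1}" for k
    unfolding P_def
  proof
    fix w assume w: "w \<in> moduli n"
    define \<tau> where "\<tau> = Transposition.transpose k n"
    define v where "v = swap_point n w k"
    have v: "v \<in> moduli n" "relabels n \<tau> w v"
      using swap_point_moduli[OF n w k] relabels_swap[OF n w k] by (simp_all add: v_def \<tau>_def)
    have \<tau>: "\<tau> permutes {1..n}"
      unfolding \<tau>_def using k n1 by (intro permutes_swap_id) auto
    have "(\<Prod>j\<in>{1..n}. cmod (leading_coeff n (a v) j)) =
        (\<Prod>i\<in>{1..n}. cmod (leading_coeff n (a v) (\<tau> i)))"
      by (rule prod.permute[OF \<tau>, unfolded o_def])
    also have "\<dots> = (\<Prod>i\<in>{1..n}. cmod (swap_multiplier n w k i) * cmod (leading_coeff n (a w) i))"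
      unfolding v_def \<tau>_def
      by (intro prod.cong refl
          leading_coeff_swap[OF n w k unif[OF w] unif[OF swap_point_moduli[OF n w k]]])
    finally have "(\<Prod>j\<in>{1..n}. cmod (leading_coeff n (a v) j)) * cmod (transposition_factor n k w) =
        (\<Prod>i\<in>{1..n}. cmod (leading_coeff n (a w) i))"
      using prod_swap_multiplier[OF n w k] by (simp add: prod.distrib mult_ac)
    then have "?H v * (cmod (transposition_factor n k w))\<^sup>2 = ?H w"
      unfolding cusp_product_leading_coeff[OF n1(3)] power_mult_distrib[symmetric] by simp
    then show "\<exists>v. relabels n (Transposition.transpose k n) w v \<and>
        ?H v * (cmod (f (Transposition.transpose k n) w))\<^sup>2 = ?H w"
      using v(2) factor[OF k w] by (auto simp: \<tau>_def)
  qed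
  have P_id: "P id"
    unfolding P_def
  proof
    fix w assume w: "w \<in> moduli n"
    define \<tau> where "\<tau> = Transposition.transpose 1 n"
    have \<tau>: "\<tau> permutes {1..n}"
      unfolding \<tau>_def using n1 by (intro permutes_swap_id) auto
    \<comment> \<open>The law at a transposition \<open>\<tau>\<close> shows that \<open>f \<tau>\<close> has no zeros, so the cocycle relation for \<open>\<tau> \<circ> id\<close>
      gives \<open>|f id| = 1\<close>.\<close>
    have "P \<tau>" unfolding \<tau>_def by (rule P_swap[OF n1(2)])
    then have "f \<tau> w \<noteq> 0"
      using w H_pos[OF w] by (auto simp: P_def)
    moreover have "cmod (f \<tau> w) = cmod (f \<tau> w) * cmod (f id w)"
      using cocycle[OF \<tau> permutes_id w] relabels_symm_act[OF n permutes_id relabels_id[OF w]] by simp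
    ultimately have "cmod (f id w) = 1" by simp
    then show "\<exists>v. relabels n id w v \<and> ?H v * (cmod (f id w))\<^sup>2 = ?H w"
      using relabels_id[OF w] by auto
  qed
  have P_comp: "P (p \<circ> q)"
    if p: "p permutes {1..n}" "P p" and q: "q permutes {1..n}" "P q" for p q
    unfolding P_def
  proof
    fix w assume w: "w \<in> moduli n"
    obtain v where v: "relabels n q w v" "?H v * (cmod (f q w))\<^sup>2 = ?H w"
      using q(2) w by (auto simp: P_def)
    then have "v \<in> moduli n" by (simp add: relabels_def)
    then obtain u where u: "relabels n p v u" "?H u * (cmod (f p v))\<^sup>2 = ?H v"
      using p(2) by (auto simp: P_def)
    have "cmod (f (p \<circ> q) w) = cmod (f p v) * cmod (f q w)"
      using cocycle[OF p(1) q(1) w] relabels_symm_act[OF n q(1) v(1)] by simp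
    then have "?H u * (cmod (f (p \<circ> q) w))\<^sup>2 = ?H w"
      using u(2) v(2) by (simp add: power_mult_distrib mult.assoc[symmetric])
    then show "\<exists>u. relabels n (p \<circ> q) w u \<and> ?H u * (cmod (f (p \<circ> q) w))\<^sup>2 = ?H w"
      using relabels_comp[OF q(1) v(1) u(1)] by blast
  qed
  have "?H (symm_act n p w) * (cmod (f p w))\<^sup>2 = ?H w"
    if p: "p permutes {1..n}" and w: "w \<in> moduli n" for p w
  proof -
    have "P p"
      by (rule transpositions_generate[OF p P_id P_swap P_comp])
    then show ?thesis
      using w relabels_symm_act[OF n p] by (auto simp: P_def)
  qed
  then show ?thesis
    using smooth H_pos unfolding determines_hermitian_metric_def cusp_product_def by blast
qed

end
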